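(* Let $1<p<\infty$ and let $p'$ be the conjugate exponent, $\frac1p+\frac1{p'}=1$. The dual space $(H^p)^*$ can be identified with $H^{p'}$; more precisely, there exists an isomorphism of Banach spaces $\Phi:H^{p'}\to(H^p)^*$ (a bounded bijection with bounded inverse, not necessarily isometric).
   Context: Lattice points $(m,n)\in\mathbb Z^2$ are identified with $m+in\in\mathbb C$. Let $\mathbb Z^2_+=\{m+in: m,n\in\mathbb Z,\ n\geqslant 0\}$. A function $f:\mathbb Z^2_+\to\mathbb C$ is discrete holomorphic, written $f\in\operatorname{Hol}(\mathbb Z^2_+)$, if $f(z)+i f(z+1)-f(z+1+i)-i f(z+i)=0$ for every $z\in\mathbb Z^2_+$. For $1\leqslant p\leqslant\infty$, $H^p=H^p(\mathbb Z^2_+)=\{f\in\operatorname{Hol}(\mathbb Z^2_+): \|f\|_{H^p}:=\sup_{n\geqslant 0}\|f(\cdot+in)\|_{\ell^p(\mathbb Z)}<\infty\}$, a Banach space with norm $\|\cdot\|_{H^p}$. $(H^p)^*$ is the space of bounded linear functionals on $H^p$. The identification is through the pairing $\langle f,g\rangle=\sum_{m\in\mathbb Z}f(m)\overline{g(m)}$, $f\in H^p$, $g\in H^{p'}$, i.e. $\Phi(g)=\langle\,\cdot\,,g\rangle$; with this (sesquilinear) pairing $\Phi$ is conjugate-linear in $g$. *)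

theory Defs
  imports "HOL-Analysis.Analysis"
begin

text \<open>The pair \<open>(m, n)\<close> stands for the lattice point \<open>m + i n\<close> of the closed upper half-lattice
  \<open>{m + i n : m, n integers, n \<ge> 0}\<close>.\<close>

type_synonym half_lattice = "int \<times> nat"

definition discrete_hol :: "(half_lattice \<Rightarrow> complex) \<Rightarrow> bool" where
  "discrete_hol f \<longleftrightarrow>
     (\<forall>m n. f (m, n) + \<i> * f (m + 1, n) - f (m + 1, n + 1) - \<i> * f (m, n + 1) = 0)"

definition in_lp :: "real \<Rightarrow> (int \<Rightarrow> complex) \<Rightarrow> bool" where
  "in_lp p a \<longleftrightarrow> (\<lambda>m. norm (a m) powr p) summable_on UNIV"

text \<open>Only meaningful together with \<open>in_lp p a\<close>: a divergent \<open>infsum\<close> is 0.\<close>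

definition lp_norm :: "real \<Rightarrow> (int \<Rightarrow> complex) \<Rightarrow> real" where
  "lp_norm p a = (\<Sum>\<^sub>\<infinity>m. norm (a m) powr p) powr (1 / p)"

definition level :: "(half_lattice \<Rightarrow> complex) \<Rightarrow> nat \<Rightarrow> int \<Rightarrow> complex" where
  "level f n = (\<lambda>m. f (m, n))"

text \<open>The Hardy space for a finite exponent \<open>p\<close>. Finiteness of the supremum of the norms of the levels is
  expressed by the conditions \<open>in_lp\<close> and \<open>bdd_above\<close>.\<close>

definition Hp :: "real \<Rightarrow> (half_lattice \<Rightarrow> complex) set" where
  "Hp p = {f. discrete_hol f \<and> (\<forall>n. in_lp p (level f n)) \<and>
              bdd_above (range (\<lambda>n. lp_norm p (level f n)))}"

definition Hp_norm :: "real \<Rightarrow> (half_lattice \<Rightarrow> complex) \<Rightarrow> real" where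
  "Hp_norm p f = (SUP n. lp_norm p (level f n))"

text \<open>A functional on the carrier \<open>Hp p\<close> is represented by a function on the whole type that
  vanishes off \<open>Hp p\<close>. Each functional thus has exactly one representative, and the vector space
  operations of the dual are the pointwise ones.\<close>

definition Hp_dual :: "real \<Rightarrow> ((half_lattice \<Rightarrow> complex) \<Rightarrow> complex) set" where
  "Hp_dual p = {\<phi>.
     (\<forall>f\<in>Hp p. \<forall>g\<in>Hp p. \<phi> (\<lambda>z. f z + g z) = \<phi> f + \<phi> g) \<and>
     (\<forall>c. \<forall>f\<in>Hp p. \<phi> (\<lambda>z. c * f z) = c * \<phi> f) \<and>
     (\<exists>C. \<forall>f\<in>Hp p. norm (\<phi> f) \<le> C * Hp_norm p f) \<and>
     (\<forall>f. f \<notin> Hp p \<longrightarrow> \<phi> f = 0)}"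

definition Hp_dual_norm :: "real \<Rightarrow> ((half_lattice \<Rightarrow> complex) \<Rightarrow> complex) \<Rightarrow> real" where
  "Hp_dual_norm p \<phi> = (SUP f\<in>{f \<in> Hp p. Hp_norm p f \<le> 1}. norm (\<phi> f))"

definition pairing :: "(half_lattice \<Rightarrow> complex) \<Rightarrow> (half_lattice \<Rightarrow> complex) \<Rightarrow> complex" where
  "pairing f g = (\<Sum>\<^sub>\<infinity>m. f (m, 0) * cnj (g (m, 0)))"

text \<open>Isomorphisms here are conjugate-linear, because the pairing is conjugate-linear in its
  second argument.\<close>

definition antilinear_iso_to_dual ::
  "real \<Rightarrow> real \<Rightarrow> ((half_lattice \<Rightarrow> complex) \<Rightarrow> (half_lattice \<Rightarrow> complex) \<Rightarrow> complex) \<Rightarrow> bool" where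
  "antilinear_iso_to_dual q p \<Phi> \<longleftrightarrow>
     (\<forall>g\<in>Hp q. \<forall>h\<in>Hp q. \<Phi> (\<lambda>z. g z + h z) = (\<lambda>f. \<Phi> g f + \<Phi> h f)) \<and>
     (\<forall>c. \<forall>g\<in>Hp q. \<Phi> (\<lambda>z. c * g z) = (\<lambda>f. cnj c * \<Phi> g f)) \<and>
     bij_betw \<Phi> (Hp q) (Hp_dual p) \<and>
     (\<exists>C. \<forall>g\<in>Hp q. Hp_dual_norm p (\<Phi> g) \<le> C * Hp_norm q g) \<and>
     (\<exists>C. \<forall>\<phi>\<in>Hp_dual p. Hp_norm q (inv_into (Hp q) \<Phi> \<phi>) \<le> C * Hp_dual_norm p \<phi>)"

end

theory Submission
  imports Defs "HOL-Complex_Analysis.Complex_Analysis"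
begin

text \<open>In Fourier terms, passing from one level to the next multiplies by
  \<open>w = (1 + i e\<^sup>i\<^sup>\<theta>) / (e\<^sup>i\<^sup>\<theta> + i) = cos \<theta> / (1 + sin \<theta>)\<close>, which is real, decreases from \<open>1\<close> to \<open>-1\<close> on the
  half circle \<open>0 \<le> \<theta> \<le> \<pi>\<close> and exceeds \<open>1\<close> in modulus on the other half. So the bottom levels of \<open>H\<^sup>p\<close>
  are the \<open>\<ell>\<^sup>p\<close> sequences with spectrum in that half circle, and the duality follows from the duality of
  \<open>\<ell>\<^sup>p\<close> and \<open>\<ell>\<^sup>q\<close> once the self-adjoint projection onto this spectrum, composed with the \<open>n\<close>-th power
  of the multiplier, is bounded on \<open>\<ell>\<^sup>p\<close> uniformly in \<open>n\<close>. Since \<open>w\<^sup>n\<close> has variation at most \<open>2\<close>, that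
  operator is an average of projections onto arcs, hence of modulated discrete Hilbert transforms.
  The discrete Hilbert transform is bounded by Stein's argument: for nonnegative data and
  \<open>1 < p \<le> 2\<close>, the analytic function \<open>F(z) = \<Sum> a\<^sub>k i / (z - k)\<close> has positive real part,
  \<open>|F|\<^sup>p \<le> A (Re F)\<^sup>p - B Re F\<^sup>p\<close>, and the integral of \<open>F\<^sup>p\<close> over a horizontal line vanishes.\<close>

subsection \<open>Finite sections of sequence norms\<close>

text \<open>Outside \<open>p = 2\<close> there is no Plancherel theorem to characterise the bottom
  levels by their spectrum. The substitute is an explicit kernel, an integral over \<open>t\<close>
  in \<open>[-1, 1]\<close>. At height 0 the kernel and its reflection add up to the identity. The
  sum of a function of \<open>H^p\<close> against the reflected kernel does not depend on the
  height, and the decay of the kernel makes it tend to 0; hence the kernel reproduces the function.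
  Operator bounds are proved as bounds for bilinear forms over finite sets. There convergence is no
  issue, modulation leaves both norms unchanged, and transposition carries the range
  \<open>p \<le> 2\<close>, to which Stein's inequality is tied because \<open>p * arg F\<close>
  must stay within \<open>[-pi, pi]\<close>, over to \<open>p > 2\<close>. A functional on
  \<open>H^p\<close> becomes one on all of \<open>\<ell>^p\<close> by composition with the
  projection. Its coefficient sequence lies in \<open>\<ell>^q\<close>, and projecting that sequence
  gives the representing function. Each of the two projections costs a norm constant.\<close>

definition fin_norm :: "real \<Rightarrow> 'a set \<Rightarrow> ('a \<Rightarrow> complex) \<Rightarrow> real" where
  "fin_norm p F a = (\<Sum>k\<in>F. norm (a k) powr p) powr (1 / p)"

lemma conjugate_exponent:
  fixes p q :: real
  assumes "1 < p" "1 / p + 1 / q = 1"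
  shows "1 < q" "p * q = p + q" "(p - 1) * q = p" "1 / q + 1 / p = 1"
proof -
  have q: "1 / q = 1 - 1 / p" using assms by linarith
  have "1 / q > 0" using assms unfolding q by simp
  hence q0: "q > 0" by (simp add: zero_less_divide_iff)
  have "1 / q < 1" using assms unfolding q by simp
  thus "1 < q" using q0 by (simp add: divide_less_eq)
  have "p * q * (1 / p + 1 / q) = q + p"
    using assms q0 by (simp add: field_simps)
  thus pq: "p * q = p + q" using assms by simp
  show "(p - 1) * q = p" using pq by (simp add: algebra_simps)
  show "1 / q + 1 / p = 1" using assms by simp
qed

lemma powr_powr_inverse: "x \<ge> 0 \<Longrightarrow> p > 0 \<Longrightarrow> (x powr (1 / p)) powr p = (x::real)"
  by (simp add: powr_powr)

lemma powr_inverse_powr: "x \<ge> 0 \<Longrightarrow> p > 0 \<Longrightarrow> (x powr p) powr (1 / p) = (x::real)"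
  by (simp add: powr_powr)

lemma fin_norm_nonneg [simp]: "fin_norm p F a \<ge> 0"
  by (simp add: fin_norm_def)

lemma fin_norm_powr: "p > 0 \<Longrightarrow> fin_norm p F a powr p = (\<Sum>k\<in>F. norm (a k) powr p)"
  unfolding fin_norm_def by (rule powr_powr_inverse) (auto intro: sum_nonneg)

lemma fin_norm_eq_0:
  assumes "finite F" "p > 0" "fin_norm p F a = 0" "k \<in> F"
  shows "a k = 0"
proof -
  have "(\<Sum>k\<in>F. norm (a k) powr p) = 0"
    using fin_norm_powr[OF assms(2), of F a] assms by simp
  hence "norm (a k) powr p = 0"
    using assms by (subst (asm) sum_nonneg_eq_0_iff) auto
  thus ?thesis by simp
qed

lemma fin_norm_mono:
  assumes "p > 0" "\<And>k. k \<in> F \<Longrightarrow> norm (a k) \<le> norm (b k)"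
  shows "fin_norm p F a \<le> fin_norm p F b"
  unfolding fin_norm_def using assms
  by (intro powr_mono2 sum_mono) (auto intro!: sum_nonneg powr_mono2)

lemma fin_norm_cong:
  "(\<And>k. k \<in> F \<Longrightarrow> norm (a k) = norm (b k)) \<Longrightarrow> fin_norm p F a = fin_norm p F b"
  unfolding fin_norm_def by (metis (mono_tags, lifting) sum.cong)

lemma Holder_finite:
  assumes "finite F" and p: "1 < p" and pq: "1 / p + 1 / q = 1"
  shows "(\<Sum>k\<in>F. norm (a k) * norm (b k)) \<le> fin_norm p F a * fin_norm q F b"
proof -
  note c = conjugate_exponent[OF p pq]
  define A where "A = fin_norm p F a"
  define B where "B = fin_norm q F b"
  show ?thesis
  proof (cases "A = 0 \<or> B = 0")
    case True
    hence "norm (a k) * norm (b k) = 0" if "k \<in> F" for k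
      using fin_norm_eq_0[OF \<open>finite F\<close>, of p a k] fin_norm_eq_0[OF \<open>finite F\<close>, of q b k] that p c
      by (auto simp: A_def B_def)
    thus ?thesis by (simp add: sum.neutral)
  next
    case False
    hence pos: "A > 0" "B > 0"
      using fin_norm_nonneg[of p F a] fin_norm_nonneg[of q F b] by (auto simp: A_def B_def less_le)
    have Ap: "A powr p = (\<Sum>k\<in>F. norm (a k) powr p)" "B powr q = (\<Sum>k\<in>F. norm (b k) powr q)"
      using p c by (auto simp: A_def B_def fin_norm_powr)
    have "(\<Sum>k\<in>F. (norm (a k) / A) * (norm (b k) / B))
        \<le> (\<Sum>k\<in>F. (norm (a k) / A) powr p / p + (norm (b k) / B) powr q / q)"
      using pos p c pq by (intro sum_mono Youngs_inequality) auto
    also have "\<dots> = (\<Sum>k\<in>F. norm (a k) powr p) / (A powr p) / p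
                  + (\<Sum>k\<in>F. norm (b k) powr q) / (B powr q) / q"
      using pos by (simp add: sum.distrib powr_divide sum_divide_distrib)
    also have "\<dots> = 1" using pos pq by (simp add: Ap[symmetric])
    finally have "(\<Sum>k\<in>F. norm (a k) * norm (b k)) / (A * B) \<le> 1"
      by (simp add: sum_divide_distrib)
    thus ?thesis using pos by (simp add: A_def B_def divide_le_eq)
  qed
qed

lemma converse_Holder_finite:
  assumes "finite F" and p: "1 < p" and pq: "1 / p + 1 / q = 1"
    and "M \<ge> 0" and M: "\<And>b. norm (\<Sum>k\<in>F. b k * c k) \<le> M * fin_norm q F b"
  shows "fin_norm p F c \<le> M"
proof (cases "fin_norm p F c = 0")
  case True
  thus ?thesis using \<open>M \<ge> 0\<close> by simp
next
  case False
  note cq = conjugate_exponent[OF p pq]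
  \<comment> \<open>The extremal vector for Hoelder's inequality:
    \<open>b k * c k = |c k|^p\<close>, and \<open>(p - 1) * q = p\<close> gives
    \<open>|b k|^q = |c k|^p\<close>, so both sides of the hypothesis are powers of the same sum
    \<open>S\<close>.\<close>
  define b where "b = (\<lambda>k. if c k = 0 then 0 else cnj (c k) * of_real (norm (c k) powr (p - 2)))"
  define S where "S = (\<Sum>k\<in>F. norm (c k) powr p)"
  have bc: "b k * c k = of_real (norm (c k) powr p)" for k
  proof (cases "c k = 0")
    case False
    have "norm (c k) powr (p - 2 + 2) = norm (c k) powr (p - 2) * norm (c k) ^ 2"
      using False by (subst powr_add) simp
    hence "norm (c k) powr p = norm (c k) powr (p - 2) * norm (c k) ^ 2" by simp
    moreover have "b k * c k = of_real (norm (c k) powr (p - 2)) * (c k * cnj (c k))"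
      using False by (simp add: b_def mult_ac)
    ultimately show ?thesis
      by (simp only: complex_norm_square[symmetric] of_real_mult of_real_power)
  qed (simp add: b_def)
  have nb: "norm (b k) powr q = norm (c k) powr p" for k
  proof (cases "c k = 0")
    case False
    have "norm (b k) = norm (c k) powr 1 * norm (c k) powr (p - 2)"
      using False by (simp add: b_def norm_mult)
    also have "\<dots> = norm (c k) powr (p - 1)" by (simp add: powr_mult_base)
    finally show ?thesis by (simp add: powr_powr cq)
  qed (use p cq in \<open>simp add: b_def\<close>)
  have "S \<noteq> 0" using False by (auto simp: fin_norm_def S_def)
  hence Spos: "S > 0" using sum_nonneg[of F "\<lambda>k. norm (c k) powr p"] by (simp add: S_def)
  have "S = norm (\<Sum>k\<in>F. b k * c k)"
    using Spos by (simp add: bc S_def flip: of_real_sum)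
  also have "\<dots> \<le> M * fin_norm q F b" by (rule M)
  also have "fin_norm q F b = S powr (1 / q)" by (simp add: fin_norm_def nb S_def)
  finally have "S \<le> M * S powr (1 / q)" .
  moreover have "S = S powr (1 / p) * S powr (1 / q)"
    using Spos pq by (simp flip: powr_add)
  ultimately have "S powr (1 / p) * S powr (1 / q) \<le> M * S powr (1 / q)" by simp
  hence "S powr (1 / p) \<le> M" using Spos by simp
  thus ?thesis by (simp add: fin_norm_def S_def)
qed

subsection \<open>The discrete Hilbert transform\<close>

text \<open>By homogeneity, with \<open>w = r e^(i t)\<close> and \<open>|t| < pi / 2\<close>, it
  suffices that \<open>1 \<le> A cos^p t - B cos (p t)\<close>. For \<open>|t|\<close> close to
  \<open>pi / 2\<close> the angle \<open>p |t|\<close> lies between \<open>pi / 2\<close> and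
  \<open>pi\<close>, because \<open>1 < p \<le> 2\<close>, so \<open>- cos (p t)\<close> is bounded
  below by a positive number. For the other \<open>t\<close> the first term is large.\<close>

lemma stein_pointwise:
  fixes p :: real
  assumes p: "1 < p" "p \<le> 2"
  obtains A B where "A \<ge> 0" "B \<ge> 0"
    "\<And>w. Re w > 0 \<Longrightarrow> norm w powr p \<le> A * Re w powr p - B * Re (w powr of_real p)"
proof -
  \<comment> \<open>The midpoint of \<open>pi / (2 p)\<close> and \<open>pi / 2\<close>: there the
    cosine of \<open>\<phi>\<close> is still positive while that of \<open>p * \<phi>\<close> is
    already negative. The choice of \<open>A\<close> gives
    \<open>A cos^p \<phi> = 1 + 1 / c\<close>, which absorbs the term
    \<open>(1 / c) cos (p t) \<le> 1 / c\<close>.\<close>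
  define \<phi> where "\<phi> = (pi / 2 / p + pi / 2) / 2"
  define c where "c = - cos (p * \<phi>)"
  define A where "A = (1 + 1 / c) / cos \<phi> powr p"
  have "pi / 2 / p < pi / 2" using p by (simp add: divide_less_eq)
  hence phi: "\<phi> < pi / 2" "pi / 2 / p < \<phi>" "0 < \<phi>" using p by (auto simp: \<phi>_def add_pos_pos)
  have p1: "pi / 2 < p * \<phi>" using phi p by (simp add: field_simps)
  have p2: "p * \<phi> < pi"
  proof -
    have "p * \<phi> < p * (pi / 2)" using phi p by (intro mult_strict_left_mono) auto
    also have "\<dots> \<le> 2 * (pi / 2)" using p by (intro mult_right_mono) auto
    finally show ?thesis by simp
  qed
  have c0: "c > 0"
  proof -
    have "cos (p * \<phi>) < cos (pi / 2)" using p1 p2 by (intro cos_monotone_0_pi) auto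
    thus ?thesis by (simp add: c_def)
  qed
  have cphi: "cos \<phi> > 0" using phi by (intro cos_gt_zero) auto
  have A0: "A \<ge> 0" using c0 by (simp add: A_def)
  have key: "1 \<le> A * cos t powr p - 1 / c * cos (p * t)" if t: "\<bar>t\<bar> < pi / 2" for t
  proof (cases "\<bar>t\<bar> \<le> \<phi>")
    case True
    have "cos \<phi> \<le> cos \<bar>t\<bar>" using True phi by (intro cos_monotone_0_pi_le) auto
    hence "cos \<phi> powr p \<le> cos t powr p" using cphi p by (intro powr_mono2) auto
    hence "A * cos \<phi> powr p \<le> A * cos t powr p" using A0 by (rule mult_left_mono)
    hence "1 + 1 / c \<le> A * cos t powr p" using cphi by (simp add: A_def)
    moreover have "1 / c * cos (p * t) \<le> 1 / c * 1" using c0 by (intro mult_left_mono) auto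
    ultimately show ?thesis by simp
  next
    case False
    have "p * \<bar>t\<bar> \<le> 2 * (pi / 2)" using t p by (intro mult_mono) auto
    moreover have "p * \<phi> \<le> p * \<bar>t\<bar>" using False p by (intro mult_left_mono) auto
    ultimately have "cos (p * \<bar>t\<bar>) \<le> cos (p * \<phi>)"
      using p1 by (intro cos_monotone_0_pi_le) auto
    moreover have "cos (p * \<bar>t\<bar>) = cos (p * t)" by (cases "t \<ge> 0") auto
    ultimately have "c \<le> - cos (p * t)" by (simp add: c_def)
    hence "1 / c * c \<le> 1 / c * (- cos (p * t))" using c0 by (intro mult_left_mono) auto
    hence "1 \<le> - (1 / c * cos (p * t))" using c0 by simp
    moreover have "0 \<le> A * cos t powr p" using A0 by simp
    ultimately show ?thesis by linarith
  qed
  show ?thesis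
  proof (rule that[of A "1 / c"])
    fix w :: complex assume w: "Re w > 0"
    hence w0: "w \<noteq> 0" by auto
    define r where "r = norm w"
    have r0: "r > 0" using w0 by (simp add: r_def)
    define t where "t = Im (Ln w)"
    have t: "\<bar>t\<bar> < pi / 2" using w Re_Ln_pos_lt[OF w0] by (simp only: t_def)
    have Ln: "Ln w = Complex (ln r) t" using w0 by (simp add: complex_eq_iff r_def t_def)
    have "Re (exp (Ln w)) = r * cos t" using r0 unfolding Ln by (simp add: Re_exp)
    hence Re: "Re w = r * cos t" using w0 by simp
    have Rep: "Re (w powr of_real p) = r powr p * cos (p * t)"
      using w0 r0 by (simp add: powr_def Ln Re_exp mult.commute)
    have cA: "cos (t) > 0" using t by (intro cos_gt_zero_pi) auto
    have "r powr p * 1 \<le> r powr p * (A * cos (t) powr p - 1 / c * cos (p * t))"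
      using key[OF t] by (intro mult_left_mono) auto
    thus "norm w powr p \<le> A * Re w powr p - 1 / c * Re (w powr of_real p)"
      using r0 cA unfolding Re Rep r_def[symmetric] by (simp add: powr_mult algebra_simps)
  qed (use A0 c0 in auto)
qed

section \<open>Cauchy sums in the upper half plane and their powers\<close>

definition cauchy_sum :: "int set \<Rightarrow> (int \<Rightarrow> real) \<Rightarrow> complex \<Rightarrow> complex" where
  "cauchy_sum F a z = (\<Sum>k\<in>F. of_real (a k) * (\<i> / (z - of_int k)))"

text \<open>At \<open>z - k\<close> these are, up to the factor \<open>pi\<close>, the Poisson
  kernel, positive above the axis, and the conjugate Poisson kernel, which resembles
  \<open>1 / (j - k)\<close>.\<close>

lemma Re_i_div: "Re (\<i> / z) = Im z / (norm z)\<^sup>2" and Im_i_div: "Im (\<i> / z) = Re z / (norm z)\<^sup>2"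
  by (simp_all add: Re_divide Im_divide cmod_power2)

lemma Re_cauchy_sum_pos:
  assumes "finite F" "\<And>k. a k \<ge> 0" "k \<in> F" "a k > 0" "Im z > 0"
  shows "Re (cauchy_sum F a z) > 0"
proof -
  have nz: "z - of_int k \<noteq> 0" for k using \<open>Im z > 0\<close> by (auto simp: complex_eq_iff)
  have "Re (cauchy_sum F a z) = (\<Sum>k\<in>F. a k * (Im z / (norm (z - of_int k))\<^sup>2))"
    unfolding cauchy_sum_def using \<open>Im z > 0\<close> by (simp add: Re_i_div del: times_divide_eq_right)
  also have "\<dots> > 0"
    using assms nz by (intro sum_pos2[of F k]) auto
  finally show ?thesis .
qed

text \<open>The shift by \<open>i\<close> moves the poles to the line \<open>Im z = -1\<close>, and
  the positive real part keeps the base of the power off the branch cut, so \<open>G\<close> is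
  holomorphic on a convex half plane containing the closed upper half discs. By Cauchy's theorem the
  integral over the segment equals, up to sign, the one over the semicircle of radius
  \<open>N\<close>, which is \<open>O(N^(1 - p))\<close>.\<close>

lemma cauchy_sum_powr_integral_tendsto_0:
  fixes p :: real
  assumes F: "finite F" and a: "\<And>k. a k \<ge> 0" "k0 \<in> F" "a k0 > 0"
    and p: "1 < p"
  defines "G \<equiv> (\<lambda>z. cauchy_sum F a (z + \<i>) powr of_real p)"
  shows "continuous_on {z. Im z > -1} G"
    and "(\<lambda>N::nat. contour_integral (linepath (of_real (- real N)) (of_real (real N))) G) \<longlonglongrightarrow> 0"
proof -
  define H where "H = {z. Im z > (-1::real)}"
  have H: "convex H" "open H"
    unfolding H_def by (auto simp: convex_halfspace_Im_gt open_halfspace_Im_gt)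
  have ne: "z + \<i> - of_int k \<noteq> 0" if "z \<in> H" for z and k :: int
    using that by (auto simp: complex_eq_iff H_def)
  have "cauchy_sum F a (z + \<i>) \<notin> \<real>\<^sub>\<le>\<^sub>0" if "z \<in> H" for z
    using Re_cauchy_sum_pos[of F a k0 "z + \<i>"] that F a by (auto simp: H_def complex_nonpos_Reals_iff)
  hence hol: "G holomorphic_on H"
    unfolding G_def cauchy_sum_def using ne by (intro holomorphic_intros) auto
  thus "continuous_on {z. Im z > -1} G"
    unfolding H_def[symmetric] by (rule holomorphic_on_imp_continuous_on)
  \<comment> \<open>\<open>M\<close> dominates \<open>|k| + 1\<close> for every \<open>k\<close> in
    \<open>F\<close>; hence \<open>|z + i - k| \<ge> N / 2\<close> on the semicircle as soon as
    \<open>N \<ge> 2 M\<close>.\<close>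
  define M where "M = (\<Sum>k\<in>F. \<bar>of_int k\<bar>) + (1::real)"
  define S where "S = (\<Sum>k\<in>F. a k)"
  have kM: "\<bar>of_int k\<bar> + 1 \<le> M" if "k \<in> F" for k
    using member_le_sum[of k F "\<lambda>k. \<bar>of_int k\<bar> :: real"] that F by (auto simp: M_def)
  have bd: "norm (contour_integral (linepath (of_real (- real N)) (of_real (real N))) G)
      \<le> (2 * S / N) powr p * N * pi" if N: "real N \<ge> 2 * M" "N > 0" for N
  proof -
    let ?l = "linepath (of_real (- real N)) (of_real (real N)) :: real \<Rightarrow> complex"
    let ?c = "part_circlepath 0 (real N) 0 pi"
    have pl: "path_image ?l \<subseteq> H"
      unfolding path_image_linepath using H by (intro closed_segment_subset) (auto simp: H_def)
    have pc: "path_image ?c \<subseteq> H"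
    proof
      fix z assume "z \<in> path_image ?c"
      then obtain t where t: "0 \<le> t" "t \<le> pi" "z = of_real (real N) * exp (\<i> * of_real t)"
        by (auto simp: path_image_part_circlepath)
      have "Im z = N * sin t" using t by (simp add: Im_exp)
      moreover have "N * sin t \<ge> 0" using t by (intro mult_nonneg_nonneg sin_ge_zero) auto
      ultimately have "- 1 < Im z" by linarith
      thus "z \<in> H" by (simp add: H_def)
    qed
    have conn: "pathfinish ?l = pathstart ?c" "pathfinish ?c = pathstart ?l"
      by simp_all
    have "(G has_contour_integral 0) (?l +++ ?c)"
    proof (rule Cauchy_theorem_convex_simple[OF hol H(1)])
      show "valid_path (?l +++ ?c)"
        using conn by (intro valid_path_join) (simp_all only: valid_path_linepath valid_path_part_circlepath)
      show "path_image (?l +++ ?c) \<subseteq> H"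
        using pl pc by (simp only: path_image_join[OF conn(1)] Un_subset_iff)
      show "pathfinish (?l +++ ?c) = pathstart (?l +++ ?c)"
        by (simp only: pathfinish_join pathstart_join conn)
    qed
    have il: "G contour_integrable_on ?l"
      using hol pl by (intro contour_integrable_continuous_linepath)
        (metis holomorphic_on_imp_continuous_on continuous_on_subset path_image_linepath)
    have ic: "G contour_integrable_on ?c"
      using hol pc by (intro contour_integrable_continuous_part_circlepath)
        (metis holomorphic_on_imp_continuous_on continuous_on_subset)
    have "contour_integral ?l G + contour_integral ?c G = 0"
      using contour_integral_join[OF il ic] \<open>(G has_contour_integral 0) (?l +++ ?c)\<close>
      by (metis contour_integral_unique valid_path_linepath valid_path_part_circlepath)
    hence "norm (contour_integral ?l G) = norm (contour_integral ?c G)"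
      by (metis add_eq_0_iff norm_minus_cancel)
    also have "\<dots> \<le> (2 * S / N) powr p * N * \<bar>pi - 0\<bar>"
    proof (rule contour_integral_bound_part_circlepath[OF ic])
      fix z assume z: "z \<in> path_image ?c"
      hence "norm z = N"
        by (auto simp: path_image_part_circlepath norm_mult)
      hence zk: "norm (z + \<i> - of_int k) \<ge> N / 2" if "k \<in> F" for k
      proof -
        have "norm z \<le> norm (z + \<i> - of_int k) + norm (of_int k - \<i> :: complex)"
          using norm_triangle_ineq[of "z + \<i> - of_int k" "of_int k - \<i>"] by simp
        also have "norm (of_int k - \<i> :: complex) \<le> \<bar>of_int k\<bar> + 1"
          using norm_triangle_ineq4[of "of_int k" "\<i>"] by simp
        finally show ?thesis using kM[OF that] N \<open>norm z = N\<close> by simp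
      qed
      have "norm (cauchy_sum F a (z + \<i>)) \<le> (\<Sum>k\<in>F. a k * (2 / N))"
        unfolding cauchy_sum_def
      proof (rule sum_norm_le)
        fix k assume k: "k \<in> F"
        have "norm (of_real (a k) * (\<i> / (z + \<i> - of_int k))) = a k * (1 / norm (z + \<i> - of_int k))"
          using a by (simp add: norm_mult norm_divide)
        also have "\<dots> \<le> a k * (1 / (N / 2))"
          using zk[OF k] N a by (intro mult_left_mono frac_le) auto
        finally show "norm (of_real (a k) * (\<i> / (z + \<i> - of_int k))) \<le> a k * (2 / N)" by simp
      qed
      also have "\<dots> = 2 * S / N"
        unfolding S_def sum_divide_distrib sum_distrib_left by (simp add: mult_ac)
      finally show "norm (G z) \<le> (2 * S / N) powr p"
        unfolding G_def using p by (simp add: norm_powr_real_powr' powr_mono2)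
    qed auto
    finally show ?thesis by simp
  qed
  have S0: "S \<ge> 0" using a by (simp add: S_def sum_nonneg)
  have "(\<lambda>N::nat. (2 * S) powr p * pi * real N powr (1 - p)) \<longlonglongrightarrow> (2 * S) powr p * pi * 0"
    using p by (intro tendsto_intros tendsto_neg_powr filterlim_real_sequentially) auto
  hence lim: "(\<lambda>N::nat. (2 * S) powr p * pi * real N powr (1 - p)) \<longlonglongrightarrow> 0" by simp
  show "(\<lambda>N::nat. contour_integral (linepath (of_real (- real N)) (of_real (real N))) G) \<longlonglongrightarrow> 0"
  proof (rule Lim_null_comparison[OF _ lim])
    have "\<forall>\<^sub>F N in sequentially. real N \<ge> 2 * M"
      using filterlim_real_sequentially by (auto simp: filterlim_at_top)
    moreover have "\<forall>\<^sub>F N in sequentially. N > (0::nat)" by (rule eventually_gt_at_top)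
    ultimately show "\<forall>\<^sub>F N::nat in sequentially. norm (contour_integral (linepath (of_real (- real N)) (of_real (real N))) G)
      \<le> (2 * S) powr p * pi * real N powr (1 - p)"
    proof eventually_elim
      case (elim N)
      have "(2 * S / N) powr p * N * pi = (2 * S) powr p * pi * (real N powr 1 / real N powr p)"
        using S0 elim by (simp add: powr_divide)
      also have "real N powr 1 / real N powr p = real N powr (1 - p)" by (simp only: powr_diff)
      finally show ?case using bd[of N] elim by (simp add: mult_ac)
    qed
  qed
qed

section \<open>Comparison of the Hilbert kernel with Poisson kernels\<close>

definition quad_decay :: "int \<Rightarrow> real" where
  "quad_decay l = 1 / (1 + (of_int l)\<^sup>2)"

definition inv_kernel :: "int \<Rightarrow> real" where
  "inv_kernel l = (if l = 0 then 0 else 1 / of_int l)"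

lemma quad_decay_pos [simp]: "quad_decay l > 0"
  by (simp add: quad_decay_def add_pos_nonneg)

lemma quad_decay_nonneg [simp]: "quad_decay l \<ge> 0"
  by (simp add: less_imp_le)

lemma inverse_le_scaled:
  fixes A B c :: real
  assumes "A > 0" "B > 0" "B \<le> c * A"
  shows "1 / A \<le> c * (1 / B)"
  using assms by (simp add: field_simps)

text \<open>The bound has to be uniform in the offset \<open>s\<close>, because the inequality built
  on it is integrated over a unit interval.\<close>

lemma Poisson_le_quad_decay:
  assumes "0 \<le> s" "s \<le> 1"
  shows "1 / ((of_int l + s)\<^sup>2 + 1) \<le> 3 * quad_decay l"
proof -
  define x where "x = of_int l + s"
  have "(of_int l)\<^sup>2 = (x - s)\<^sup>2" by (simp add: x_def)
  also have "\<dots> \<le> 2 * x\<^sup>2 + 2 * s\<^sup>2"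
    using zero_le_power2[of "x + s"] by (simp add: power2_eq_square algebra_simps)
  finally have "1 + (of_int l)\<^sup>2 \<le> 3 * (x\<^sup>2 + 1)"
    using assms power_mono[of s 1 2] zero_le_power2[of x] unfolding distrib_left by (simp; linarith)
  thus ?thesis unfolding x_def[symmetric] quad_decay_def
    by (intro inverse_le_scaled) (auto intro: add_nonneg_pos add_pos_nonneg)
qed

text \<open>Both kernels behave like \<open>1 / l\<close>. With \<open>x = l + s\<close> their
  difference is \<open>(x s + 1) / (l (x^2 + 1))\<close>, whose numerator grows only linearly, so
  quadratic decay remains. At \<open>l = 0\<close> the value \<open>inv_kernel 0 = 0\<close> leaves
  a bounded term.\<close>

lemma inv_kernel_conjugate_Poisson:
  assumes "0 \<le> s" "s \<le> 1"
  shows "\<bar>inv_kernel l - (of_int l + s) / ((of_int l + s)\<^sup>2 + 1)\<bar> \<le> 4 * quad_decay l"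
proof (cases "l = 0")
  case True
  have "s \<le> s\<^sup>2 + 1" using assms zero_le_power2[of s] by linarith
  hence "\<bar>s / (s\<^sup>2 + 1)\<bar> \<le> 1" using assms by (simp add: divide_le_eq_1 add_nonneg_pos)
  thus ?thesis using True by (simp add: inv_kernel_def quad_decay_def)
next
  case False
  define x where "x = of_int l + s"
  define L where "L = \<bar>real_of_int l\<bar>"
  have L: "L \<ge> 1" using False by (simp add: L_def)
  have x1: "x\<^sup>2 + 1 > 0" by (simp add: add_nonneg_pos)
  have "inv_kernel l - x / (x\<^sup>2 + 1) = (x * s + 1) / (of_int l * (x\<^sup>2 + 1))"
    using False x1 by (simp add: inv_kernel_def field_simps x_def power2_eq_square)
  hence "\<bar>inv_kernel l - x / (x\<^sup>2 + 1)\<bar> = \<bar>x * s + 1\<bar> / (L * (x\<^sup>2 + 1))"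
    using x1 by (simp add: abs_mult L_def)
  also have "\<dots> \<le> (\<bar>x\<bar> + 1) / (L * (x\<^sup>2 + 1))"
  proof (intro divide_right_mono)
    have "\<bar>x\<bar> * \<bar>s\<bar> \<le> \<bar>x\<bar> * 1" using assms by (intro mult_left_mono) auto
    thus "\<bar>x * s + 1\<bar> \<le> \<bar>x\<bar> + 1" unfolding abs_mult[symmetric] by linarith
  qed (use L x1 in auto)
  also have "\<dots> \<le> 4 / (1 + L\<^sup>2)"
  proof -
    have "L \<le> \<bar>x\<bar> + 1" using assms by (auto simp: L_def x_def)
    have "(\<bar>x\<bar> + 1) * (1 + L\<^sup>2) \<le> (\<bar>x\<bar> + 1) * (2 * L * L)"
      using L by (intro mult_left_mono) (auto simp: power2_eq_square intro: mult_ge1_I)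
    also have "\<dots> \<le> (\<bar>x\<bar> + 1) * (2 * L * (\<bar>x\<bar> + 1))"
      using L \<open>L \<le> \<bar>x\<bar> + 1\<close> by (intro mult_left_mono) auto
    also have "\<dots> = 2 * L * (\<bar>x\<bar> + 1)\<^sup>2" by (simp add: power2_eq_square)
    also have "\<dots> \<le> 2 * L * (2 * (x\<^sup>2 + 1))"
    proof (intro mult_left_mono)
      have "0 \<le> (\<bar>x\<bar> - 1)\<^sup>2" by simp
      thus "(\<bar>x\<bar> + 1)\<^sup>2 \<le> 2 * (x\<^sup>2 + 1)" unfolding power2_sum power2_diff by simp
    qed (use L in auto)
    finally show ?thesis using L x1 by (simp add: divide_simps add_pos_nonneg mult_ac)
  qed
  also have "4 / (1 + L\<^sup>2) = 4 * quad_decay l" by (simp add: quad_decay_def L_def)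
  finally show ?thesis by (simp add: x_def)
qed

lemma powr_add_le:
  fixes x y p :: real
  assumes "x \<ge> 0" "y \<ge> 0" "p \<ge> 0"
  shows "(x + y) powr p \<le> 2 powr p * (x powr p + y powr p)"
proof -
  have "(x + y) powr p \<le> (2 * max x y) powr p" using assms by (intro powr_mono2) auto
  also have "\<dots> = 2 powr p * max x y powr p" using assms by (simp add: powr_mult)
  also have "\<dots> \<le> 2 powr p * (x powr p + y powr p)"
    by (intro mult_left_mono) (auto simp: max_def)
  finally show ?thesis .
qed

text \<open>On the line \<open>Im z = 1\<close>, the real part of \<open>cauchy_sum\<close> and the difference of its imaginary part from
  the discrete Hilbert transform are both controlled by convolution with the summable \<open>quad_decay\<close>.\<close>

lemma inv_kernel_sum_powr_le:
  fixes p :: real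
  assumes p: "1 < p" "p \<le> 2"
  obtains C B where "C \<ge> 0" "B \<ge> 0"
    "\<And>F (a :: int \<Rightarrow> real) k0 j s. finite F \<Longrightarrow> (\<And>k. a k \<ge> 0) \<Longrightarrow> k0 \<in> F \<Longrightarrow> a k0 > 0 \<Longrightarrow> 0 \<le> s \<Longrightarrow> s \<le> 1 \<Longrightarrow>
      \<bar>\<Sum>k\<in>F. a k * inv_kernel (j - k)\<bar> powr p \<le> C * (\<Sum>k\<in>F. a k * quad_decay (j - k)) powr p
        - B * Re (cauchy_sum F a (of_int j + of_real s + \<i>) powr of_real p)"
proof -
  obtain A B where AB: "A \<ge> 0" "B \<ge> 0"
    "\<And>w. Re w > 0 \<Longrightarrow> norm w powr p \<le> A * Re w powr p - B * Re (w powr of_real p)"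
    using stein_pointwise[OF p] by metis
  \<comment> \<open>The factors 3 and 4 come from the two kernel comparisons, and
    \<open>2 powr p\<close> from splitting the \<open>p\<close>-th power of
    \<open>norm w + 4 * D\<close>. The term with \<open>B\<close> is kept exactly, since it
    disappears only after integration.\<close>
  show ?thesis
  proof (rule that[of "2 powr p * (A * 3 powr p + 4 powr p)" "2 powr p * B"])
    fix F :: "int set" and a :: "int \<Rightarrow> real" and k0 j s
    assume F: "finite F" and a: "\<And>k. a k \<ge> 0" "k0 \<in> F" "a k0 > 0" and s: "0 \<le> s" "s \<le> (1::real)"
    define z where "z = of_int j + of_real s + \<i>"
    define w where "w = cauchy_sum F a z"
    define D where "D = (\<Sum>k\<in>F. a k * quad_decay (j - k))"
    have D0: "D \<ge> 0" unfolding D_def using a by (intro sum_nonneg mult_nonneg_nonneg) (auto intro: less_imp_le)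
    have w0: "Re w > 0" unfolding w_def by (rule Re_cauchy_sum_pos[where k = k0]) (use F a in \<open>auto simp: z_def\<close>)
    have Imz: "Im z = 1" by (simp add: z_def)
    have nz: "(norm (z - of_int k))\<^sup>2 = (of_int (j - k) + s)\<^sup>2 + 1" for k
      by (simp add: cmod_power2 z_def algebra_simps)
    have Rew: "Re w = (\<Sum>k\<in>F. a k * (1 / ((of_int (j - k) + s)\<^sup>2 + 1)))"
      unfolding w_def cauchy_sum_def using Imz by (simp add: Re_i_div nz del: times_divide_eq_right of_int_diff)
    have Imw: "Im w = (\<Sum>k\<in>F. a k * ((of_int (j - k) + s) / ((of_int (j - k) + s)\<^sup>2 + 1)))"
      unfolding w_def cauchy_sum_def
      by (simp add: Im_i_div nz del: times_divide_eq_right of_int_diff) (simp add: z_def algebra_simps)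
    have Re_le: "Re w \<le> 3 * D"
    proof -
      have "Re w \<le> (\<Sum>k\<in>F. a k * (3 * quad_decay (j - k)))"
        unfolding Rew using a s by (intro sum_mono mult_left_mono Poisson_le_quad_decay) auto
      thus ?thesis by (simp add: D_def sum_distrib_left mult_ac)
    qed
    have "\<bar>(\<Sum>k\<in>F. a k * inv_kernel (j - k)) - Im w\<bar> \<le> (\<Sum>k\<in>F. a k * (4 * quad_decay (j - k)))"
      unfolding Imw sum_subtractf[symmetric] right_diff_distrib[symmetric]
    proof (rule order_trans[OF sum_abs], rule sum_mono)
      fix k
      show "\<bar>a k * (inv_kernel (j - k) - (of_int (j - k) + s) / ((of_int (j - k) + s)\<^sup>2 + 1))\<bar>
          \<le> a k * (4 * quad_decay (j - k))"
        unfolding abs_mult abs_of_nonneg[OF a(1)]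
        by (rule mult_left_mono[OF inv_kernel_conjugate_Poisson[OF s] a(1)])
    qed
    hence "\<bar>\<Sum>k\<in>F. a k * inv_kernel (j - k)\<bar> \<le> \<bar>Im w\<bar> + 4 * D"
      by (simp add: D_def sum_distrib_left mult_ac)
    also have "\<dots> \<le> norm w + 4 * D" using abs_Im_le_cmod[of w] by simp
    finally have "\<bar>\<Sum>k\<in>F. a k * inv_kernel (j - k)\<bar> powr p \<le> (norm w + 4 * D) powr p"
      using p by (intro powr_mono2) auto
    also have "\<dots> \<le> 2 powr p * (norm w powr p + (4 * D) powr p)"
      using p D0 by (intro powr_add_le) auto
    also have "\<dots> \<le> 2 powr p * ((A * (3 * D) powr p - B * Re (w powr of_real p)) + (4 * D) powr p)"
    proof (intro mult_left_mono add_right_mono)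
      have "A * Re w powr p \<le> A * (3 * D) powr p"
        using Re_le w0 p AB by (intro mult_left_mono powr_mono2) auto
      thus "norm w powr p \<le> A * (3 * D) powr p - B * Re (w powr of_real p)"
        using AB(3)[OF w0] by linarith
    qed auto
    also have "\<dots> = 2 powr p * (A * 3 powr p + 4 powr p) * D powr p - 2 powr p * B * Re (w powr of_real p)"
      using D0 by (simp add: powr_mult algebra_simps)
    finally show "\<bar>\<Sum>k\<in>F. a k * inv_kernel (j - k)\<bar> powr p
      \<le> 2 powr p * (A * 3 powr p + 4 powr p) * (\<Sum>k\<in>F. a k * quad_decay (j - k)) powr p
        - 2 powr p * B * Re (cauchy_sum F a (of_int j + of_real s + \<i>) powr of_real p)"
      by (simp add: w_def D_def z_def)
  qed (use AB in auto)
qed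

lemma sum_integral_unit_intervals:
  fixes h :: "real \<Rightarrow> real"
  assumes "continuous_on UNIV h"
  shows "(\<Sum>j\<in>{- int N..<int N}. integral {of_int j..of_int j + 1} h) = integral {- real N..real N} h"
proof (induction N)
  case (Suc N)
  have I: "h integrable_on {a..b}" for a b
    by (intro integrable_continuous_interval continuous_on_subset[OF assms]) auto
  have "{- int (Suc N)..<int (Suc N)} = insert (- int N - 1) (insert (int N) {- int N..<int N})"
    by auto
  hence "(\<Sum>j\<in>{- int (Suc N)..<int (Suc N)}. integral {of_int j..of_int j + 1} h) =
    integral {- real N - 1..- real N} h + (integral {real N..real N + 1} h + integral {- real N..real N} h)"
    using Suc by simp
  also have "integral {real N..real N + 1} h + integral {- real N..real N} h = integral {- real N..real N + 1} h"
    using Henstock_Kurzweil_Integration.integral_combine[OF _ _ I, of "- real N" "real N" "real N + 1"] by simp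
  also have "integral {- real N - 1..- real N} h + integral {- real N..real N + 1} h = integral {- real N - 1..real N + 1} h"
    using Henstock_Kurzweil_Integration.integral_combine[OF _ _ I, of "- real N - 1" "- real N" "real N + 1"] by simp
  also have "{- real N - 1..real N + 1} = {- real (Suc N)..real (Suc N)}" by simp
  finally show ?case .
qed simp

lemma summable_on_int_powr:
  fixes r :: real
  assumes "r > 1"
  shows "(\<lambda>m::int. (1 + \<bar>of_int m\<bar>) powr (- r)) summable_on UNIV"
proof -
  let ?f = "\<lambda>m::int. (1 + \<bar>of_int m\<bar>) powr (- r)"
  have "summable (\<lambda>n. real n powr (- r))" using assms by (simp add: summable_real_powr_iff)
  hence "summable (\<lambda>n. real (Suc n) powr (- r))" by (subst summable_Suc_iff)
  hence s: "(\<lambda>n::nat. (1 + real n) powr (- r)) summable_on UNIV"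
    by (intro summable_nonneg_imp_summable_on) (auto simp: add_ac)
  have "?f summable_on range int"
    by (subst summable_on_reindex) (use s in \<open>auto simp: o_def\<close>)
  moreover have "?f summable_on range (\<lambda>n. - int n)"
    by (subst summable_on_reindex) (use s in \<open>auto simp: o_def inj_on_def\<close>)
  ultimately have "?f summable_on (range int \<union> range (\<lambda>n. - int n))" by (rule summable_on_union)
  also have "range int \<union> range (\<lambda>n. - int n) = UNIV"
  proof -
    have "m \<in> range int \<union> range (\<lambda>n. - int n)" for m
      by (cases m rule: int_cases2) blast+
    thus ?thesis by blast
  qed
  finally show ?thesis .
qed

lemma quad_decay_sum_bounded:
  obtains Q where "Q > 0" "\<And>F j. finite F \<Longrightarrow> (\<Sum>k\<in>F. quad_decay (j - k)) \<le> Q"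
    "\<And>F k. finite F \<Longrightarrow> (\<Sum>j\<in>F. quad_decay (j - k)) \<le> Q"
proof -
  have "quad_decay l \<le> 2 * (1 + \<bar>of_int l\<bar>) powr (- 2)" for l
  proof -
    have "(1 + \<bar>real_of_int l\<bar>)\<^sup>2 \<le> 2 * (1 + (real_of_int l)\<^sup>2)"
      using zero_le_power2[of "1 - \<bar>real_of_int l\<bar>"] unfolding power2_sum power2_diff by simp
    hence "1 / (1 + (real_of_int l)\<^sup>2) \<le> 2 * (1 / (1 + \<bar>real_of_int l\<bar>)\<^sup>2)"
      by (intro inverse_le_scaled) (auto intro: add_pos_nonneg)
    moreover have "(1 + \<bar>real_of_int l\<bar>) powr (- 2) = 1 / (1 + \<bar>real_of_int l\<bar>)\<^sup>2"
      by (simp only: powr_minus_divide powr_numeral abs_ge_zero add_nonneg_nonneg zero_le_one)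
    ultimately show ?thesis by (simp add: quad_decay_def)
  qed
  moreover have "(\<lambda>l::int. 2 * (1 + \<bar>of_int l\<bar>) powr (- 2 :: real)) summable_on UNIV"
    by (rule summable_on_cmult_right) (rule summable_on_int_powr, simp)
  ultimately have sq: "quad_decay summable_on UNIV"
    using less_imp_le[OF quad_decay_pos] by (rule_tac summable_on_comparison_test)
  have bound: "(\<Sum>k\<in>F. quad_decay (g k)) \<le> infsum quad_decay UNIV" if "finite F" "inj g" for F and g :: "int \<Rightarrow> int"
  proof -
    have "(\<Sum>k\<in>F. quad_decay (g k)) = sum quad_decay (g ` F)"
      using that by (subst sum.reindex) (auto intro: inj_on_subset)
    also have "\<dots> \<le> infsum quad_decay UNIV"
      using that sq by (intro finite_sum_le_infsum) (auto intro: less_imp_le)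
    finally show ?thesis .
  qed
  have "quad_decay 0 \<le> infsum quad_decay UNIV" using bound[of "{0}" id] by simp
  hence "infsum quad_decay UNIV > 0" using quad_decay_pos[of 0] by linarith
  thus ?thesis
    by (rule that) (auto intro!: bound simp: inj_def)
qed

text \<open>Schur's test: write the kernel as the product of its powers \<open>1 / p\<close> and
  \<open>1 / q\<close>, apply Hoelder's inequality in \<open>k\<close>, and then sum over
  \<open>j\<close>. Only the bound \<open>Q\<close> for row and column sums enters.\<close>

lemma quad_decay_convolution_bounded:
  fixes p :: real
  assumes p: "1 < p"
  obtains C where "C \<ge> 0" "\<And>F G (a :: int \<Rightarrow> real). finite F \<Longrightarrow> finite G \<Longrightarrow> (\<And>k. a k \<ge> 0) \<Longrightarrow>
    (\<Sum>j\<in>G. (\<Sum>k\<in>F. a k * quad_decay (j - k)) powr p) \<le> C * (\<Sum>k\<in>F. a k powr p)"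
proof -
  obtain Q where Q: "Q > 0" "\<And>F j. finite F \<Longrightarrow> (\<Sum>k\<in>F. quad_decay (j - k)) \<le> Q"
    "\<And>F k. finite F \<Longrightarrow> (\<Sum>j\<in>F. quad_decay (j - k)) \<le> Q"
    by (rule quad_decay_sum_bounded) blast
  define q where "q = p / (p - 1)"
  have pq: "1 / p + 1 / q = 1" using p by (simp add: q_def field_simps)
  note c = conjugate_exponent[OF p pq]
  show ?thesis
  proof (rule that[of "Q powr (p / q) * Q"])
    fix F G :: "int set" and a :: "int \<Rightarrow> real" assume F: "finite F" and G: "finite G" and a: "\<And>k. a k \<ge> 0"
    have "(\<Sum>k\<in>F. a k * quad_decay (j - k)) powr p \<le> Q powr (p / q) * (\<Sum>k\<in>F. a k powr p * quad_decay (j - k))" for j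
    proof -
      let ?x = "\<lambda>k. complex_of_real (a k * quad_decay (j - k) powr (1 / p))"
      let ?y = "\<lambda>k. complex_of_real (quad_decay (j - k) powr (1 / q))"
      have "norm (?x k) * norm (?y k) = a k * quad_decay (j - k)" for k
      proof -
        have "quad_decay (j - k) powr (1 / p) * quad_decay (j - k) powr (1 / q) = quad_decay (j - k)"
          unfolding powr_add[symmetric] pq using less_imp_le[OF quad_decay_pos[of "j - k"]] by simp
        thus ?thesis using a less_imp_le[OF quad_decay_pos[of "j - k"]] by (simp add: norm_mult)
      qed
      hence "(\<Sum>k\<in>F. a k * quad_decay (j - k)) = (\<Sum>k\<in>F. norm (?x k) * norm (?y k))" by simp
      also have "\<dots> \<le> fin_norm p F ?x * fin_norm q F ?y" by (rule Holder_finite[OF F p pq])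
      finally have "(\<Sum>k\<in>F. a k * quad_decay (j - k)) powr p \<le> (fin_norm p F ?x * fin_norm q F ?y) powr p"
        using p a by (intro powr_mono2) (auto intro!: sum_nonneg mult_nonneg_nonneg intro: less_imp_le)
      also have "\<dots> = fin_norm p F ?x powr p * fin_norm q F ?y powr p" by (simp add: powr_mult)
      also have "fin_norm p F ?x powr p = (\<Sum>k\<in>F. a k powr p * quad_decay (j - k))"
        using p a by (subst fin_norm_powr) (auto simp: norm_mult powr_mult powr_powr)
      also have "fin_norm q F ?y powr p = (\<Sum>k\<in>F. quad_decay (j - k)) powr (p / q)"
        using c by (simp add: fin_norm_def powr_powr)
      also have "(\<Sum>k\<in>F. a k powr p * quad_decay (j - k)) * (\<Sum>k\<in>F. quad_decay (j - k)) powr (p / q)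
         \<le> (\<Sum>k\<in>F. a k powr p * quad_decay (j - k)) * Q powr (p / q)"
        using p c Q F by (intro mult_left_mono powr_mono2)
          (auto intro!: sum_nonneg mult_nonneg_nonneg intro: less_imp_le)
      finally show ?thesis by (simp add: mult.commute)
    qed
    hence "(\<Sum>j\<in>G. (\<Sum>k\<in>F. a k * quad_decay (j - k)) powr p)
        \<le> (\<Sum>j\<in>G. Q powr (p / q) * (\<Sum>k\<in>F. a k powr p * quad_decay (j - k)))"
      by (rule sum_mono)
    also have "\<dots> = Q powr (p / q) * (\<Sum>k\<in>F. a k powr p * (\<Sum>j\<in>G. quad_decay (j - k)))"
      unfolding sum_distrib_left by (subst sum.swap) simp
    also have "\<dots> \<le> Q powr (p / q) * (\<Sum>k\<in>F. a k powr p * Q)"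
      using Q G by (intro mult_left_mono sum_mono) auto
    also have "\<dots> = Q powr (p / q) * Q * (\<Sum>k\<in>F. a k powr p)"
      by (simp add: sum_distrib_left mult_ac)
    finally show "(\<Sum>j\<in>G. (\<Sum>k\<in>F. a k * quad_decay (j - k)) powr p) \<le> Q powr (p / q) * Q * (\<Sum>k\<in>F. a k powr p)" .
  qed (use Q in auto)
qed

text \<open>Integrating the pointwise inequality over each unit interval and summing over
  \<open>j\<close> from \<open>-N\<close> to \<open>N - 1\<close> joins the integrals to one over
  \<open>[-N, N]\<close>, which tends to 0. What survives is the convolution with
  \<open>quad_decay\<close>.\<close>

lemma inv_kernel_nonneg_bounded:
  fixes p :: real
  assumes p: "1 < p" "p \<le> 2"
  obtains C where "C \<ge> 0" "\<And>F G (a :: int \<Rightarrow> real). finite F \<Longrightarrow> finite G \<Longrightarrow> (\<And>k. a k \<ge> 0) \<Longrightarrow>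
    (\<Sum>j\<in>G. \<bar>\<Sum>k\<in>F. a k * inv_kernel (j - k)\<bar> powr p) \<le> C * (\<Sum>k\<in>F. a k powr p)"
proof -
  obtain C B where CB: "C \<ge> 0" "B \<ge> 0"
    "\<And>F (a :: int \<Rightarrow> real) k0 j s. finite F \<Longrightarrow> (\<And>k. a k \<ge> 0) \<Longrightarrow> k0 \<in> F \<Longrightarrow> a k0 > 0 \<Longrightarrow> 0 \<le> s \<Longrightarrow> s \<le> 1 \<Longrightarrow>
      \<bar>\<Sum>k\<in>F. a k * inv_kernel (j - k)\<bar> powr p \<le> C * (\<Sum>k\<in>F. a k * quad_decay (j - k)) powr p
        - B * Re (cauchy_sum F a (of_int j + of_real s + \<i>) powr of_real p)"
    by (rule inv_kernel_sum_powr_le[OF p]) blast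
  obtain Y where Y: "Y \<ge> 0" "\<And>F G (a :: int \<Rightarrow> real). finite F \<Longrightarrow> finite G \<Longrightarrow> (\<And>k. a k \<ge> 0) \<Longrightarrow>
    (\<Sum>j\<in>G. (\<Sum>k\<in>F. a k * quad_decay (j - k)) powr p) \<le> Y * (\<Sum>k\<in>F. a k powr p)"
    by (rule quad_decay_convolution_bounded[OF p(1)]) blast
  show ?thesis
  proof (rule that[of "C * Y"])
    fix F G :: "int set" and a :: "int \<Rightarrow> real" assume F: "finite F" and G: "finite G" and a: "\<And>k. a k \<ge> 0"
    let ?H = "\<lambda>j. \<bar>\<Sum>k\<in>F. a k * inv_kernel (j - k)\<bar> powr p"
    let ?D = "\<lambda>j. (\<Sum>k\<in>F. a k * quad_decay (j - k)) powr p"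
    \<comment> \<open>A positive entry is what makes the real part of the Cauchy sum positive, so
      the zero sequence is treated apart.\<close>
    show "sum ?H G \<le> C * Y * (\<Sum>k\<in>F. a k powr p)"
    proof (cases "\<exists>k0\<in>F. a k0 > 0")
      case False
      hence "a k = 0" if "k \<in> F" for k using a[of k] that by (metis less_eq_real_def)
      thus ?thesis by simp
    next
      case True
      then obtain k0 where k0: "k0 \<in> F" "a k0 > 0" by blast
      define g where "g = (\<lambda>z. cauchy_sum F a (z + \<i>) powr of_real p)"
      define h where "h = (\<lambda>x. Re (g (of_real x)))"
      note lim = cauchy_sum_powr_integral_tendsto_0[of F a k0 p, OF F a k0 p(1), folded g_def]
      have contg: "continuous_on S (\<lambda>x. g (of_real x))" for S :: "real set"
        by (intro continuous_on_compose2[OF lim(1)]) (auto intro!: continuous_intros)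
      have conth: "continuous_on S h" for S unfolding h_def by (intro continuous_intros contg)
      have "(\<lambda>N. Re (contour_integral (linepath (of_real (- real N)) (of_real (real N))) g)) \<longlonglongrightarrow> Re 0"
        using lim(2) by (intro tendsto_Re)
      moreover have "Re (contour_integral (linepath (of_real (- real N)) (of_real (real N))) g) = integral {- real N..real N} h" for N
      proof (cases "N = 0")
        case False
        hence "contour_integral (linepath (of_real (- real N)) (of_real (real N))) g = integral {- real N..real N} (\<lambda>x. g (of_real x))"
          by (subst contour_integral_linepath_Reals_eq) (auto intro!: Reals_of_real simp del: of_real_minus)
        moreover have "(\<lambda>x. g (of_real x)) integrable_on {- real N..real N}"
          by (intro integrable_continuous_interval contg)
        hence "Re (integral {- real N..real N} (\<lambda>x. g (of_real x))) = integral {- real N..real N} h"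
          unfolding h_def by (simp add: integral_linear[OF _ bounded_linear_Re, unfolded o_def, symmetric])
        ultimately show ?thesis by simp
      qed (simp add: contour_integral_trivial)
      ultimately have "(\<lambda>N. integral {- real N..real N} h) \<longlonglongrightarrow> 0" by simp
      hence "(\<lambda>N. C * Y * (\<Sum>k\<in>F. a k powr p) - B * integral {- real N..real N} h)
          \<longlonglongrightarrow> C * Y * (\<Sum>k\<in>F. a k powr p) - B * 0"
        by (intro tendsto_intros)
      hence lim2: "(\<lambda>N. C * Y * (\<Sum>k\<in>F. a k powr p) - B * integral {- real N..real N} h)
          \<longlonglongrightarrow> C * Y * (\<Sum>k\<in>F. a k powr p)" by simp
      \<comment> \<open>The two sums depend on \<open>j\<close> only and are constant on the unit
        interval, which has length 1; only \<open>h\<close> is really integrated.\<close>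
      have unit: "?H j \<le> C * ?D j - B * integral {of_int j..of_int j + 1} h" for j
      proof -
        have "integral {real_of_int j..of_int j + 1} (\<lambda>x. B * h x) \<le> integral {real_of_int j..of_int j + 1} (\<lambda>x. C * ?D j - ?H j)"
        proof (intro integral_le)
          fix x assume x: "x \<in> {of_int j..of_int j + (1::real)}"
          have "of_int j + of_real (x - of_int j) + \<i> = of_real x + \<i>" by simp
          thus "B * h x \<le> C * ?D j - ?H j"
            using CB(3)[of F a k0 "x - of_int j" j, OF F a k0] x by (simp add: h_def g_def)
        qed (intro integrable_continuous_interval continuous_intros conth)+
        thus ?thesis by simp
      qed
      obtain N0 where N0: "\<And>j. j \<in> G \<Longrightarrow> \<bar>j\<bar> < int N0"
      proof -
        have "\<bar>j\<bar> < int (nat ((\<Sum>j\<in>G. \<bar>j\<bar>) + 1))" if "j \<in> G" for j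
          using member_le_sum[of j G abs] G that by auto
        thus ?thesis using that by blast
      qed
      \<comment> \<open>\<open>G\<close> is enlarged to a full symmetric block, harmless since the
        summands are nonnegative, so that the unit intervals fit together without gaps.\<close>
      have "sum ?H G \<le> C * Y * (\<Sum>k\<in>F. a k powr p) - B * integral {- real N..real N} h" if "N \<ge> N0" for N
      proof -
        have "sum ?H G \<le> sum ?H {- int N..<int N}"
          using N0 that by (intro sum_mono2) (fastforce simp: abs_less_iff)+
        also have "\<dots> \<le> (\<Sum>j\<in>{- int N..<int N}. C * ?D j - B * integral {of_int j..of_int j + 1} h)"
          by (intro sum_mono unit)
        also have "\<dots> = C * sum ?D {- int N..<int N} - B * integral {- real N..real N} h"
          by (simp add: sum_subtractf sum_distrib_left[symmetric] sum_integral_unit_intervals[OF conth])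
        also have "\<dots> \<le> C * (Y * (\<Sum>k\<in>F. a k powr p)) - B * integral {- real N..real N} h"
          using Y(2)[of F _ a, OF F _ a] CB(1) by (intro diff_right_mono mult_left_mono) auto
        finally show ?thesis by (simp add: mult_ac)
      qed
      thus ?thesis by (intro LIMSEQ_le_const[OF lim2]) blast
    qed
  qed (use CB Y in auto)
qed

section \<open>The Hilbert form for complex data and all exponents\<close>

lemma inv_kernel_uminus: "inv_kernel (- l) = - inv_kernel l"
  by (simp add: inv_kernel_def)

lemma Hilbert_form_bounded_nonneg:
  fixes p q :: real
  assumes p: "1 < p" "p \<le> 2" and pq: "1 / p + 1 / q = 1"
  obtains C where "C \<ge> 0" "\<And>F (a :: int \<Rightarrow> real) b. finite F \<Longrightarrow> (\<And>k. a k \<ge> 0) \<Longrightarrow>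
    norm (\<Sum>j\<in>F. \<Sum>k\<in>F. of_real (inv_kernel (j - k)) * of_real (a k) * b j)
      \<le> C * (fin_norm p F (\<lambda>k. of_real (a k)) * fin_norm q F b)"
proof -
  obtain C where C: "C \<ge> 0" "\<And>F G (a :: int \<Rightarrow> real). finite F \<Longrightarrow> finite G \<Longrightarrow> (\<And>k. a k \<ge> 0) \<Longrightarrow>
    (\<Sum>j\<in>G. \<bar>\<Sum>k\<in>F. a k * inv_kernel (j - k)\<bar> powr p) \<le> C * (\<Sum>k\<in>F. a k powr p)"
    by (rule inv_kernel_nonneg_bounded[OF p]) blast
  show ?thesis
  proof (rule that[of "C powr (1 / p)"])
    fix F :: "int set" and a :: "int \<Rightarrow> real" and b :: "int \<Rightarrow> complex"
    assume F: "finite F" and a: "\<And>k. a k \<ge> 0"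
    let ?H = "\<lambda>j. complex_of_real (\<Sum>k\<in>F. a k * inv_kernel (j - k))"
    have "(\<Sum>j\<in>F. \<Sum>k\<in>F. of_real (inv_kernel (j - k)) * of_real (a k) * b j) = (\<Sum>j\<in>F. ?H j * b j)"
      by (simp add: sum_distrib_left mult_ac)
    hence "norm (\<Sum>j\<in>F. \<Sum>k\<in>F. of_real (inv_kernel (j - k)) * of_real (a k) * b j)
        \<le> (\<Sum>j\<in>F. norm (?H j) * norm (b j))"
      by (simp add: sum_norm_le norm_mult del: of_real_sum)
    also have "\<dots> \<le> fin_norm p F ?H * fin_norm q F b" by (rule Holder_finite[OF F p(1) pq])
    also have "fin_norm p F ?H \<le> (C * (\<Sum>k\<in>F. a k powr p)) powr (1 / p)"
      unfolding fin_norm_def norm_of_real using C(2)[of F F a, OF F F a] p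
      by (intro powr_mono2) (auto intro: sum_nonneg)
    also have "\<dots> = C powr (1 / p) * fin_norm p F (\<lambda>k. of_real (a k))"
      using a C(1) by (simp add: powr_mult sum_nonneg fin_norm_def)
    finally show "norm (\<Sum>j\<in>F. \<Sum>k\<in>F. of_real (inv_kernel (j - k)) * of_real (a k) * b j)
      \<le> C powr (1 / p) * (fin_norm p F (\<lambda>k. of_real (a k)) * fin_norm q F b)"
      by (simp add: mult_right_mono mult_ac)
  qed simp
qed

text \<open>The positive and negative parts of \<open>Re a\<close> and \<open>Im a\<close> are four
  nonnegative sequences dominated by \<open>|a|\<close>; hence the factor 4.\<close>

lemma Hilbert_form_bounded_le2:
  fixes p q :: real
  assumes p: "1 < p" "p \<le> 2" and pq: "1 / p + 1 / q = 1"
  obtains C where "C \<ge> 0" "\<And>F a b. finite F \<Longrightarrow>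
    norm (\<Sum>j\<in>F. \<Sum>k\<in>F. of_real (inv_kernel (j - k)) * a k * b j)
      \<le> C * (fin_norm p F a * fin_norm q F b)"
proof -
  obtain C where C: "C \<ge> 0" "\<And>F (a :: int \<Rightarrow> real) b. finite F \<Longrightarrow> (\<And>k. a k \<ge> 0) \<Longrightarrow>
    norm (\<Sum>j\<in>F. \<Sum>k\<in>F. of_real (inv_kernel (j - k)) * of_real (a k) * b j)
      \<le> C * (fin_norm p F (\<lambda>k. of_real (a k)) * fin_norm q F b)"
    by (rule Hilbert_form_bounded_nonneg[OF p pq]) blast
  show ?thesis
  proof (rule that[of "4 * C"])
    fix F :: "int set" and a b :: "int \<Rightarrow> complex" assume F: "finite F"
    define T where "T = (\<lambda>a :: int \<Rightarrow> complex. \<Sum>j\<in>F. \<Sum>k\<in>F. of_real (inv_kernel (j - k)) * a k * b j)"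
    define M where "M = C * (fin_norm p F a * fin_norm q F b)"
    have part: "norm (T (\<lambda>k. of_real (r k))) \<le> M" if r: "\<And>k. 0 \<le> r k" "\<And>k. r k \<le> norm (a k)" for r
    proof -
      have "norm (T (\<lambda>k. of_real (r k))) \<le> C * (fin_norm p F (\<lambda>k. of_real (r k)) * fin_norm q F b)"
        unfolding T_def using C(2)[of F r, OF F r(1)] .
      also have "\<dots> \<le> M" unfolding M_def using C(1) p r
        by (intro mult_left_mono mult_right_mono fin_norm_mono) auto
      finally show ?thesis .
    qed
    define u where "u = (\<lambda>x k. max 0 (x (a k)) :: real)"
    define v where "v = (\<lambda>x. T (\<lambda>k. of_real (u x k)))"
    have "a k = of_real (u Re k) - of_real (u (\<lambda>z. - Re z) k)
        + \<i> * of_real (u Im k) - \<i> * of_real (u (\<lambda>z. - Im z) k)" for k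
      by (auto simp: complex_eq_iff max_def u_def)
    hence "a = (\<lambda>k. of_real (u Re k) - of_real (u (\<lambda>z. - Re z) k)
        + \<i> * of_real (u Im k) - \<i> * of_real (u (\<lambda>z. - Im z) k))" by (rule ext)
    hence Ta: "T a = v Re - v (\<lambda>z. - Re z) + \<i> * v Im - \<i> * v (\<lambda>z. - Im z)"
      unfolding T_def v_def sum_distrib_left sum_subtractf[symmetric] sum.distrib[symmetric]
      by (simp add: algebra_simps)
    have "norm (T a) \<le> norm (v Re) + norm (v (\<lambda>z. - Re z)) + norm (\<i> * v Im) + norm (\<i> * v (\<lambda>z. - Im z))"
      unfolding Ta
      using norm_triangle_ineq4[of "v Re" "v (\<lambda>z. - Re z)"]
        norm_triangle_ineq[of "v Re - v (\<lambda>z. - Re z)" "\<i> * v Im"]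
        norm_triangle_ineq4[of "v Re - v (\<lambda>z. - Re z) + \<i> * v Im" "\<i> * v (\<lambda>z. - Im z)"] by linarith
    also have "\<dots> \<le> M + M + M + M"
    proof -
      have "norm (v x) \<le> M" if "\<And>z. x z \<le> norm z" for x
        unfolding v_def by (rule part) (auto simp: u_def that)
      hence "norm (v Re) \<le> M" "norm (v (\<lambda>z. - Re z)) \<le> M" "norm (v Im) \<le> M" "norm (v (\<lambda>z. - Im z)) \<le> M"
        using abs_Re_le_cmod abs_Im_le_cmod by (simp_all add: abs_le_iff)
      thus ?thesis by (simp add: norm_mult)
    qed
    finally show "norm (\<Sum>j\<in>F. \<Sum>k\<in>F. of_real (inv_kernel (j - k)) * a k * b j)
      \<le> 4 * C * (fin_norm p F a * fin_norm q F b)"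
      by (simp add: T_def M_def)
  qed (use C in auto)
qed

text \<open>One of two conjugate exponents is at most 2. The kernel is odd, so exchanging the roles
  of \<open>a\<close> and \<open>b\<close> changes the form only by a sign, and the bound for the
  pair \<open>(q, p)\<close> gives the one for \<open>(p, q)\<close>.\<close>

lemma Hilbert_form_bounded:
  fixes p q :: real
  assumes p: "1 < p" and pq: "1 / p + 1 / q = 1"
  obtains C where "C \<ge> 0" "\<And>F a b. finite F \<Longrightarrow>
    norm (\<Sum>j\<in>F. \<Sum>k\<in>F. of_real (inv_kernel (j - k)) * a k * b j)
      \<le> C * (fin_norm p F a * fin_norm q F b)"
proof (cases "p \<le> 2")
  case True
  show ?thesis by (rule Hilbert_form_bounded_le2[OF p True pq]) (rule that)
next
  case False
  note c = conjugate_exponent[OF p pq]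
  have "q \<le> 2"
  proof (rule ccontr)
    assume "\<not> q \<le> 2"
    hence "1 / q < 1 / 2" "1 / p < 1 / 2" using False by (auto intro!: divide_strict_left_mono)
    thus False using pq by linarith
  qed
  then obtain C where C: "C \<ge> 0" "\<And>F a b. finite F \<Longrightarrow>
    norm (\<Sum>j\<in>F. \<Sum>k\<in>F. of_real (inv_kernel (j - k)) * a k * b j)
      \<le> C * (fin_norm q F a * fin_norm p F b)"
    by (rule Hilbert_form_bounded_le2[OF c(1) _ c(4)]) blast
  show ?thesis
  proof (rule that[OF C(1)])
    fix F :: "int set" and a b :: "int \<Rightarrow> complex" assume F: "finite F"
    have "(\<Sum>j\<in>F. \<Sum>k\<in>F. of_real (inv_kernel (j - k)) * a k * b j)
       = (\<Sum>k\<in>F. \<Sum>j\<in>F. - (of_real (inv_kernel (k - j)) * b j * a k))"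
    proof (subst sum.swap, intro sum.cong refl)
      fix j k
      show "complex_of_real (inv_kernel (j - k)) * a k * b j = - (of_real (inv_kernel (k - j)) * b j * a k)"
        using inv_kernel_uminus[of "k - j"] by simp
    qed
    hence "norm (\<Sum>j\<in>F. \<Sum>k\<in>F. of_real (inv_kernel (j - k)) * a k * b j)
        = norm (\<Sum>k\<in>F. \<Sum>j\<in>F. of_real (inv_kernel (k - j)) * b j * a k)"
      by (simp add: sum_negf)
    also have "\<dots> \<le> C * (fin_norm q F b * fin_norm p F a)" by (rule C(2)[OF F])
    finally show "norm (\<Sum>j\<in>F. \<Sum>k\<in>F. of_real (inv_kernel (j - k)) * a k * b j)
      \<le> C * (fin_norm p F a * fin_norm q F b)" by (simp add: mult_ac)
  qed
qed

subsection \<open>The kernel of the half-circle projection\<close>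

text \<open>\<open>zeta t\<close> is the point \<open>e\<^sup>i\<^sup>\<theta>\<close> of the half circle at which the multiplier \<open>w\<close> takes the value \<open>t\<close>.
  The substitution \<open>t = w\<close>, \<open>d\<theta> = - 2 dt / (1 + t\<^sup>2)\<close>, turns the Fourier coefficient of \<open>w\<^sup>n\<close> on the half
  circle into \<open>hardy_kernel n m\<close>, and that of the arc \<open>w \<ge> t\<close> into \<open>arc_kernel t m\<close>.\<close>

definition zeta :: "real \<Rightarrow> complex" where
  "zeta t = (1 - \<i> * of_real t) / (of_real t - \<i>)"

definition hardy_kernel :: "nat \<Rightarrow> int \<Rightarrow> complex" where
  "hardy_kernel n m = integral {-1..1} (\<lambda>t. of_real (t ^ n) * zeta t powi m / of_real (1 + t\<^sup>2)) / of_real pi"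

definition arc_kernel :: "real \<Rightarrow> int \<Rightarrow> complex" where
  "arc_kernel t m = \<i> / (2 * of_real pi) * of_real (inv_kernel m) * (1 - zeta t powi m)
     + (if m = 0 then of_real (1 / 4 - arctan t / pi) else 0)"

section \<open>Calculus along the half circle\<close>

lemma zeta_denominator: "of_real t - \<i> \<noteq> 0"
  by (simp add: complex_eq_iff)

lemma norm_zeta [simp]: "norm (zeta t) = 1"
proof -
  have "norm (1 - \<i> * of_real t) = norm (of_real t - \<i>)"
    by (simp add: cmod_def add.commute)
  thus ?thesis using zeta_denominator[of t] by (simp add: zeta_def norm_divide)
qed

lemma zeta_nonzero [simp]: "zeta t \<noteq> 0"
  using norm_zeta[of t] by force

lemma zeta_1: "zeta 1 = 1" and zeta_minus_1: "zeta (- 1) = - 1"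
proof -
  show "zeta 1 = 1" using zeta_denominator[of 1] by (simp add: zeta_def)
  have "- 1 - \<i> \<noteq> (0 :: complex)" by (simp add: complex_eq_iff)
  thus "zeta (- 1) = - 1" by (simp add: zeta_def divide_eq_eq)
qed

text \<open>The equation \<open>w = t\<close> at the point \<open>zeta t\<close>, with the
  denominator cleared; under the integral it becomes the equation of discrete holomorphy.\<close>

lemma zeta_relation: "of_real t * (zeta t + \<i>) = 1 + \<i> * zeta t"
  using zeta_denominator[of t] by (simp add: zeta_def field_simps)

lemma zeta_has_vector_derivative:
  "(zeta has_vector_derivative - 2 * \<i> * zeta t / of_real (1 + t\<^sup>2)) (at t within S)"
proof -
  have nz: "of_real t - \<i> \<noteq> 0" "1 + (of_real t)\<^sup>2 \<noteq> (0 :: complex)"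
    using zeta_denominator[of t] by (auto simp: complex_eq_iff power2_eq_square add_nonneg_eq_0_iff)
  have fact: "1 + (of_real t)\<^sup>2 = (of_real t - \<i>) * (of_real t + \<i>)"
    by (simp add: algebra_simps power2_eq_square)
  have num: "1 - \<i> * of_real t = - \<i> * (of_real t + \<i>)" by (simp add: algebra_simps)
  have "((\<lambda>z. (1 - \<i> * z) / (z - \<i>)) has_field_derivative
      ((- \<i>) * (of_real t - \<i>) - (1 - \<i> * of_real t) * 1) / ((of_real t - \<i>) * (of_real t - \<i>))) (at (of_real t))"
    using nz by (intro DERIV_divide) (auto intro!: derivative_eq_intros)
  also have "((- \<i>) * (of_real t - \<i>) - (1 - \<i> * of_real t) * 1) / ((of_real t - \<i>) * (of_real t - \<i>))
      = - 2 / ((of_real t - \<i>) * (of_real t - \<i>))"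
    by (simp add: algebra_simps)
  also have "\<dots> = - 2 * \<i> * zeta t / of_real (1 + t\<^sup>2)"
    using nz unfolding zeta_def num of_real_add of_real_1 of_real_power fact
    by (simp add: divide_simps)
  finally have "((\<lambda>x. (1 - \<i> * of_real x) / (of_real x - \<i>)) has_vector_derivative
      - 2 * \<i> * zeta t / of_real (1 + t\<^sup>2)) (at t within S)"
    by (rule has_vector_derivative_real_field)
  thus ?thesis by (simp add: zeta_def[abs_def])
qed

lemma continuous_on_zeta_powi: "continuous_on S (\<lambda>t. zeta t powi m)"
proof -
  have "continuous_on S zeta"
    by (rule continuous_on_vector_derivative) (rule zeta_has_vector_derivative)
  thus ?thesis by (intro continuous_on_power_int) auto
qed

lemma zeta_powi_has_vector_derivative:
  "((\<lambda>t. zeta t powi m) has_vector_derivative - 2 * \<i> * of_int m * zeta t powi m / of_real (1 + t\<^sup>2)) (at t within S)"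
proof -
  have "((\<lambda>z. z powi m) has_field_derivative of_int m * zeta t powi (m - 1) * 1) (at (zeta t))"
    by (intro DERIV_power_int) auto
  hence "((\<lambda>z. z powi m) has_field_derivative of_int m * zeta t powi (m - 1)) (at (zeta t) within zeta ` S)"
    by (simp add: has_field_derivative_at_within)
  from field_vector_diff_chain_within[OF zeta_has_vector_derivative this]
  have "((\<lambda>t. zeta t powi m) has_vector_derivative
      (- 2 * \<i> * zeta t / of_real (1 + t\<^sup>2)) * (of_int m * zeta t powi (m - 1))) (at t within S)"
    by (simp add: o_def)
  thus ?thesis by (simp add: power_int_diff mult_ac)
qed

text \<open>Together with the value 0 at \<open>t = 1\<close> this identifies
  \<open>arc_kernel t\<close> as the coefficient of the arc from \<open>zeta 1 = 1\<close> to
  \<open>zeta t\<close>. For \<open>m = 0\<close> the primitive is an arctangent, and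
  \<open>1 / 4\<close> is \<open>arctan 1 / pi\<close>.\<close>

lemma arc_kernel_has_vector_derivative:
  "((\<lambda>t. arc_kernel t m) has_vector_derivative - (zeta t powi m / (of_real pi * of_real (1 + t\<^sup>2)))) (at t within S)"
proof (cases "m = 0")
  case True
  have "((\<lambda>t. 1 / 4 - arctan t / pi) has_field_derivative 0 - inverse (1 + t\<^sup>2) / pi) (at t within S)"
    by (intro DERIV_diff DERIV_const DERIV_cdivide DERIV_arctan has_field_derivative_at_within)
  also have "0 - inverse (1 + t\<^sup>2) / pi = - (1 / (pi * (1 + t\<^sup>2)))"
    by (simp add: field_simps)
  finally have "((\<lambda>t. 1 / 4 - arctan t / pi) has_field_derivative - (1 / (pi * (1 + t\<^sup>2)))) (at t within S)" .
  from has_vector_derivative_of_real[OF this, where ?'a = complex]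
  show ?thesis using True by (simp add: arc_kernel_def inv_kernel_def)
next
  case False
  have "((\<lambda>t. \<i> / (2 * of_real pi) * of_real (inv_kernel m) * (1 - zeta t powi m)) has_vector_derivative
     \<i> / (2 * of_real pi) * of_real (inv_kernel m) * (0 - (- 2 * \<i> * of_int m * zeta t powi m / of_real (1 + t\<^sup>2)))) (at t within S)"
    by (intro has_vector_derivative_mult_right has_vector_derivative_diff has_vector_derivative_const
        zeta_powi_has_vector_derivative)
  also have "\<i> / (2 * of_real pi) * of_real (inv_kernel m) * (0 - (- 2 * \<i> * of_int m * zeta t powi m / of_real (1 + t\<^sup>2)))
     = - (zeta t powi m / (of_real pi * of_real (1 + t\<^sup>2)))"
    using False by (simp add: inv_kernel_def field_simps)
  finally show ?thesis using False by (simp add: arc_kernel_def)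
qed

lemma continuous_on_arc_kernel: "continuous_on S (\<lambda>t. arc_kernel t m)"
  by (rule continuous_on_vector_derivative) (rule arc_kernel_has_vector_derivative)

lemma arc_kernel_1: "arc_kernel 1 m = 0"
  by (simp add: arc_kernel_def zeta_1 arctan_one)

lemma continuous_on_hardy_integrand:
  "continuous_on S (\<lambda>t. of_real (t ^ n) * zeta t powi m / of_real (1 + t\<^sup>2))"
proof -
  have "1 + t\<^sup>2 \<noteq> (0 :: real)" for t :: real by (simp add: add_nonneg_eq_0_iff)
  hence "complex_of_real (1 + t\<^sup>2) \<noteq> 0" for t by (metis of_real_eq_0_iff)
  thus ?thesis
    by (intro continuous_on_divide continuous_on_mult continuous_on_zeta_powi continuous_on_of_real
        continuous_on_power continuous_on_add continuous_on_const continuous_on_id ballI)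
qed

text \<open>Integration by parts; the boundary term at 1 vanishes. The result is a superposition of
  arc kernels whose weights have total mass at most 3 for every \<open>n\<close>. For
  \<open>n = 0\<close> the truncated exponent \<open>n - 1\<close> is harmless, as its coefficient
  is 0.\<close>

lemma hardy_kernel_by_parts:
  "hardy_kernel n m = (- 1) ^ n * arc_kernel (- 1) m
     + integral {-1..1} (\<lambda>t. of_real (real n * t ^ (n - 1)) * arc_kernel t m)"
proof -
  let ?f = "\<lambda>t. of_real (real n * t ^ (n - 1)) * arc_kernel t m"
  let ?g = "\<lambda>t. of_real (t ^ n) * zeta t powi m / of_real (1 + t\<^sup>2)"
  have "((\<lambda>t. ?f t - ?g t / of_real pi) has_integral
      of_real (1 ^ n) * arc_kernel 1 m - of_real ((- 1) ^ n) * arc_kernel (- 1) m) {-1..1}"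
  proof (rule fundamental_theorem_of_calculus)
    fix t :: real
    have "((\<lambda>t. of_real (t ^ n) :: complex) has_vector_derivative of_real (real n * t ^ (n - 1))) (at t within {- 1..1})"
      by (intro has_vector_derivative_of_real) (auto intro!: derivative_eq_intros)
    from has_vector_derivative_mult[OF this arc_kernel_has_vector_derivative]
    have "((\<lambda>t. of_real (t ^ n) * arc_kernel t m) has_vector_derivative
       of_real (t ^ n) * - (zeta t powi m / (of_real pi * of_real (1 + t\<^sup>2)))
       + of_real (real n * t ^ (n - 1)) * arc_kernel t m) (at t within {- 1..1})" .
    also have "of_real (t ^ n) * - (zeta t powi m / (of_real pi * of_real (1 + t\<^sup>2)))
       + of_real (real n * t ^ (n - 1)) * arc_kernel t m = ?f t - ?g t / of_real pi"
      by (simp add: mult_ac)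
    finally show "((\<lambda>t. of_real (t ^ n) * arc_kernel t m) has_vector_derivative ?f t - ?g t / of_real pi)
      (at t within {- 1..1})" .
  qed simp
  hence "integral {-1..1} (\<lambda>t. ?f t - ?g t / of_real pi) = - ((- 1) ^ n * arc_kernel (- 1) m)"
    by (simp add: integral_unique arc_kernel_1)
  moreover have "integral {-1..1} (\<lambda>t. ?f t - ?g t / of_real pi) = integral {-1..1} ?f - integral {-1..1} (\<lambda>t. ?g t / of_real pi)"
  proof (rule Henstock_Kurzweil_Integration.integral_diff)
    show "?f integrable_on {- 1..1}"
      by (intro integrable_continuous_interval continuous_intros continuous_on_arc_kernel)
    show "(\<lambda>t. ?g t / of_real pi) integrable_on {- 1..1}"
      by (intro integrable_continuous_interval continuous_on_divide continuous_on_hardy_integrand continuous_on_const) simp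
  qed
  moreover have "integral {-1..1} (\<lambda>t. ?g t / of_real pi) = hardy_kernel n m"
    unfolding hardy_kernel_def by (rule integral_divide)
  ultimately show ?thesis by (simp add: algebra_simps)
qed

lemma hardy_kernel_0: "hardy_kernel 0 m = arc_kernel (- 1) m"
  by (simp add: hardy_kernel_by_parts)

text \<open>Reflecting \<open>m\<close> passes to the complementary half circle, and the two
  projections add up to the identity. In coordinates, the kernel is odd off the diagonal and equals
  \<open>1 / 2\<close> on it.\<close>

lemma hardy_kernel_0_reflect: "hardy_kernel 0 m + hardy_kernel 0 (- m) = (if m = 0 then 1 else 0)"
  by (auto simp: hardy_kernel_0 arc_kernel_def zeta_minus_1 inv_kernel_uminus power_int_minus_left
      arctan_minus arctan_one)

text \<open>Self-adjointness of the projection.\<close>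

lemma cnj_hardy_kernel_0: "cnj (hardy_kernel 0 m) = hardy_kernel 0 (- m)"
  by (auto simp: hardy_kernel_0 arc_kernel_def zeta_minus_1 inv_kernel_uminus power_int_minus_left)

text \<open>The integrands already agree: this is \<open>zeta_relation\<close> multiplied by
  \<open>t^n zeta^m / (1 + t^2)\<close>.\<close>

lemma hardy_kernel_discrete_hol:
  "hardy_kernel n m + \<i> * hardy_kernel n (m + 1)
    = hardy_kernel (Suc n) (m + 1) + \<i> * hardy_kernel (Suc n) m"
proof -
  let ?g = "\<lambda>n m t. of_real (t ^ n) * zeta t powi m / of_real (1 + t\<^sup>2)"
  have I: "?g n m integrable_on {-1..1}" "(\<lambda>t. \<i> * ?g n m t) integrable_on {-1..1}" for n m
    by (intro integrable_continuous_interval continuous_on_mult continuous_on_const continuous_on_hardy_integrand)+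
  have "?g n m t + \<i> * ?g n (m + 1) t = ?g (Suc n) (m + 1) t + \<i> * ?g (Suc n) m t" for t
  proof -
    have "?g (Suc n) (m + 1) t = ?g n m t * (of_real t * zeta t)" "?g (Suc n) m t = ?g n m t * of_real t"
      by (simp_all add: power_int_add mult_ac)
    hence "?g (Suc n) (m + 1) t + \<i> * ?g (Suc n) m t = ?g n m t * (of_real t * (zeta t + \<i>))"
      by (simp only: distrib_left distrib_right mult_ac)
    also have "\<dots> = ?g n m t + \<i> * (?g n m t * zeta t)"
      unfolding zeta_relation by (simp only: distrib_left distrib_right mult_1_left mult_1_right mult_ac)
    also have "?g n m t * zeta t = ?g n (m + 1) t"
      by (simp add: power_int_add)
    finally show ?thesis by simp
  qed
  hence "integral {-1..1} (\<lambda>t. ?g n m t + \<i> * ?g n (m + 1) t)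
    = integral {-1..1} (\<lambda>t. ?g (Suc n) (m + 1) t + \<i> * ?g (Suc n) m t)" by presburger
  moreover have "integral {-1..1} (\<lambda>t. ?g n m t + \<i> * ?g n' m' t)
    = integral {-1..1} (?g n m) + \<i> * integral {-1..1} (?g n' m')" for n m n' m'
    by (simp only: Henstock_Kurzweil_Integration.integral_add[OF I] Henstock_Kurzweil_Integration.integral_mult_right)
  ultimately show ?thesis
    unfolding hardy_kernel_def by (simp only: add_divide_distrib[symmetric] times_divide_eq_right)
qed

section \<open>Size of the kernels and boundedness of their forms\<close>

lemma has_integral_abs_power:
  "((\<lambda>t::real. \<bar>t\<bar> ^ n) has_integral 2 / (real n + 1)) {-1..1}"
proof -
  have "((\<lambda>t. t ^ n) has_integral 1 ^ (n + 1) / (n + 1) - 0 ^ (n + 1) / (n + 1)) {0..1::real}"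
  proof (rule fundamental_theorem_of_calculus)
    fix t :: real
    have "((\<lambda>t. t ^ (n + 1) / real (n + 1)) has_field_derivative real (n + 1) * t ^ (n + 1 - Suc 0) / real (n + 1)) (at t within {0..1})"
      by (intro DERIV_cdivide DERIV_pow)
    thus "((\<lambda>t. t ^ (n + 1) / real (n + 1)) has_vector_derivative t ^ n) (at t within {0..1})"
      by (simp add: has_real_derivative_iff_has_vector_derivative)
  qed simp
  hence 2: "((\<lambda>t. \<bar>t\<bar> ^ n) has_integral 1 / (real n + 1)) {0..1::real}"
    by (rule has_integral_eq_rhs[OF has_integral_eq, rotated 1]) auto
  hence 1: "((\<lambda>t. \<bar>t\<bar> ^ n) has_integral 1 / (real n + 1)) {-1..0::real}"
    by (subst (asm) has_integral_reflect_real[symmetric]) simp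
  show ?thesis using has_integral_combine[OF _ _ 1 2] by (simp add: field_simps)
qed

text \<open>Decay in the height, uniform in \<open>m\<close>. Combined with the decay in
  \<open>m\<close>, it later drives the \<open>\<ell>^q\<close> norm of the kernel to 0.\<close>

lemma norm_hardy_kernel_le_height: "norm (hardy_kernel n m) \<le> 1 / (real n + 1)"
proof -
  let ?g = "\<lambda>t. of_real (t ^ n) * zeta t powi m / of_real (1 + t\<^sup>2)"
  have "norm (integral {-1..1} ?g) \<le> integral {-1..1} (\<lambda>t. \<bar>t\<bar> ^ n)"
  proof (rule integral_norm_bound_integral)
    show "?g integrable_on {-1..1}" by (intro integrable_continuous_interval continuous_on_hardy_integrand)
    show "(\<lambda>t::real. \<bar>t\<bar> ^ n) integrable_on {-1..1}" using has_integral_abs_power by blast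
    fix t :: real
    have "norm (?g t) = \<bar>t\<bar> ^ n / (1 + t\<^sup>2)"
    proof -
      have "norm (complex_of_real (1 + t\<^sup>2)) = 1 + t\<^sup>2" unfolding norm_of_real by simp
      thus ?thesis by (simp only: norm_mult norm_divide norm_power_int norm_zeta norm_of_real power_abs) simp
    qed
    also have "\<dots> \<le> \<bar>t\<bar> ^ n / 1" by (intro divide_left_mono) (auto simp: add_pos_nonneg)
    finally show "norm (?g t) \<le> \<bar>t\<bar> ^ n" by simp
  qed
  also have "\<dots> = 2 / (real n + 1)" by (rule integral_unique[OF has_integral_abs_power])
  finally have "norm (hardy_kernel n m) \<le> (2 / (real n + 1)) / pi"
    unfolding hardy_kernel_def norm_divide norm_of_real abs_of_pos[OF pi_gt_zero]
    by (rule divide_right_mono) simp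
  also have "\<dots> \<le> (2 / (real n + 1)) / 2" using pi_ge_two by (intro divide_left_mono) auto
  also have "\<dots> = 1 / (real n + 1)" by (simp add: field_simps)
  finally show ?thesis by simp
qed

text \<open>The boundary term contributes mass 1, and \<open>n |t|^(n - 1)\<close> has integral 2
  over \<open>[-1, 1]\<close> if \<open>n > 0\<close>. Stated for a general \<open>f\<close>, so
  that it serves a single kernel value as well as a whole bilinear form.\<close>

lemma norm_by_parts_le:
  fixes f :: "real \<Rightarrow> complex"
  assumes f: "continuous_on {-1..1} f" and B: "\<And>t. norm (f t) \<le> B"
  shows "norm ((- 1) ^ n * f (- 1) + integral {-1..1} (\<lambda>t. of_real (real n * t ^ (n - 1)) * f t)) \<le> 3 * B"
proof -
  have B0: "B \<ge> 0" using B[of 0] norm_ge_zero order_trans by blast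
  have "norm (integral {-1..1} (\<lambda>t. of_real (real n * t ^ (n - 1)) * f t)) \<le> 2 * B"
  proof (cases n)
    case (Suc k)
    have hi: "((\<lambda>t::real. (B * real n) * \<bar>t\<bar> ^ k) has_integral (B * real n) * (2 / (real k + 1))) {-1..1}"
      by (intro has_integral_mult_right has_integral_abs_power)
    have "norm (integral {-1..1} (\<lambda>t. of_real (real n * t ^ (n - 1)) * f t)) \<le> integral {-1..1} (\<lambda>t. (B * real n) * \<bar>t\<bar> ^ k)"
    proof (rule integral_norm_bound_integral)
      show "(\<lambda>t. of_real (real n * t ^ (n - 1)) * f t) integrable_on {- 1..1}"
        by (intro integrable_continuous_interval continuous_intros f)
      show "(\<lambda>t. (B * real n) * \<bar>t\<bar> ^ k) integrable_on {- 1..1}" using hi by blast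
      fix t :: real
      have "norm (of_real (real n * t ^ (n - 1)) * f t) = (real n * \<bar>t\<bar> ^ k) * norm (f t)"
        using Suc by (simp only: norm_mult norm_of_real abs_mult power_abs) simp
      also have "\<dots> \<le> (real n * \<bar>t\<bar> ^ k) * B" by (intro mult_left_mono B) auto
      finally show "norm (of_real (real n * t ^ (n - 1)) * f t) \<le> (B * real n) * \<bar>t\<bar> ^ k"
        by (simp add: mult_ac)
    qed
    also have "\<dots> = (B * real n) * (2 / (real k + 1))" by (rule integral_unique[OF hi])
    also have "\<dots> = 2 * B" using Suc by (simp add: field_simps)
    finally show ?thesis .
  qed (use B0 in simp)
  moreover have "norm ((- 1) ^ n * f (- 1)) \<le> B" using B[of "- 1"] by (simp add: norm_mult norm_power)
  ultimately show ?thesis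
    using norm_triangle_ineq[of "(- 1) ^ n * f (- 1)" "integral {-1..1} (\<lambda>t. of_real (real n * t ^ (n - 1)) * f t)"]
    by linarith
qed

lemma arc_diagonal_bound: "\<bar>1 / 4 - arctan t / pi\<bar> \<le> 1"
proof -
  have "- (pi / 2) / pi < arctan t / pi" "arctan t / pi < (pi / 2) / pi"
    by (rule divide_strict_right_mono[OF arctan_lbound pi_gt_zero],
        rule divide_strict_right_mono[OF arctan_ubound pi_gt_zero])
  hence "- (1 / 2) < arctan t / pi" "arctan t / pi < 1 / 2" by simp_all
  thus ?thesis by linarith
qed

lemma norm_arc_kernel_le: "norm (arc_kernel t m) \<le> 2 / (1 + \<bar>of_int m\<bar>)"
proof (cases "m = 0")
  case True
  thus ?thesis using arc_diagonal_bound[of t]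
    by (simp add: arc_kernel_def inv_kernel_def del: of_real_diff of_real_divide)
next
  case False
  have "norm (arc_kernel t m) = 1 / (2 * pi) * (1 / \<bar>of_int m\<bar>) * norm (1 - zeta t powi m)"
    using False by (simp add: arc_kernel_def inv_kernel_def norm_mult norm_divide)
  also have "\<dots> \<le> 1 / (2 * pi) * (1 / \<bar>of_int m\<bar>) * 2"
    using norm_triangle_ineq4[of 1 "zeta t powi m"] by (intro mult_left_mono) (auto simp: norm_power_int)
  also have "1 / (2 * pi) * (1 / \<bar>of_int m\<bar>) * 2 \<le> 1 / \<bar>of_int m\<bar>"
    using False pi_ge_two by (simp add: field_simps)
  also have "1 / \<bar>of_int m\<bar> \<le> 2 / (1 + \<bar>real_of_int m\<bar>)"
  proof -
    have "\<bar>real_of_int m\<bar> \<ge> 1" using False by simp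
    thus ?thesis by (simp add: field_simps)
  qed
  finally show ?thesis .
qed

text \<open>The decay \<open>1 / |m|\<close> of Fourier coefficients of functions of bounded
  variation, uniform in \<open>n\<close>; 6 is 3 times the constant of the arc kernel.\<close>

lemma norm_hardy_kernel_le: "norm (hardy_kernel n m) \<le> 6 / (1 + \<bar>of_int m\<bar>)"
  using norm_by_parts_le[OF continuous_on_arc_kernel norm_arc_kernel_le]
  unfolding hardy_kernel_by_parts by simp

text \<open>Since \<open>zeta^(j - k) = zeta^j zeta^(-k)\<close> has modulus 1, it is absorbed into
  \<open>b\<close> and \<open>a\<close> without changing their norms. The form of an arc kernel is
  thus a difference of two Hilbert forms plus a diagonal, bounded uniformly in \<open>t\<close>;
  integration by parts multiplies the bound by 3.\<close>

lemma hardy_kernel_form_bounded: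
  fixes p q :: real
  assumes p: "1 < p" and pq: "1 / p + 1 / q = 1"
  obtains C where "C \<ge> 0" "\<And>n F a b. finite F \<Longrightarrow>
    norm (\<Sum>j\<in>F. \<Sum>k\<in>F. hardy_kernel n (j - k) * a k * b j) \<le> C * (fin_norm p F a * fin_norm q F b)"
proof -
  obtain C where C: "C \<ge> 0" "\<And>F a b. finite F \<Longrightarrow>
    norm (\<Sum>j\<in>F. \<Sum>k\<in>F. of_real (inv_kernel (j - k)) * a k * b j)
      \<le> C * (fin_norm p F a * fin_norm q F b)"
    by (rule Hilbert_form_bounded[OF p pq]) blast
  show ?thesis
  proof (rule that[of "3 * (C + 1)"])
    fix n and F :: "int set" and a b :: "int \<Rightarrow> complex" assume F: "finite F"
    define M where "M = fin_norm p F a * fin_norm q F b"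
    define f where "f = (\<lambda>t. \<Sum>j\<in>F. \<Sum>k\<in>F. arc_kernel t (j - k) * a k * b j)"
    have M0: "M \<ge> 0" by (simp add: M_def)
    have contf: "continuous_on S f" for S
      unfolding f_def by (intro continuous_intros continuous_on_arc_kernel)
    have bound: "norm (f t) \<le> (C + 1) * M" for t
    proof -
      define S where "S = (\<lambda>a b. \<Sum>j\<in>F. \<Sum>k\<in>F. of_real (inv_kernel (j - k)) * a k * b j :: complex)"
      define a' where "a' = (\<lambda>k. a k * zeta t powi (- k))"
      define b' where "b' = (\<lambda>j. b j * zeta t powi j)"
      define c where "c = 1 / 4 - arctan t / pi"
      have "arc_kernel t (j - k) * a k * b j = \<i> / (2 * of_real pi) * (of_real (inv_kernel (j - k)) * a k * b j)
        - \<i> / (2 * of_real pi) * (of_real (inv_kernel (j - k)) * a' k * b' j)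
        + (if k = j then of_real c * a k * b j else 0)" for j k
        by (auto simp: arc_kernel_def a'_def b'_def c_def power_int_diff power_int_minus field_simps)
      hence "f t = \<i> / (2 * of_real pi) * S a b - \<i> / (2 * of_real pi) * S a' b'
        + (\<Sum>j\<in>F. \<Sum>k\<in>F. if k = j then of_real c * a k * b j else 0)"
        unfolding f_def S_def sum_distrib_left by (simp only: sum.distrib sum_subtractf)
      also have "(\<Sum>j\<in>F. \<Sum>k\<in>F. if k = j then of_real c * a k * b j else 0) = of_real c * (\<Sum>j\<in>F. a j * b j)"
        using F by (simp add: sum_distrib_left mult_ac)
      finally have ft: "f t = \<i> / (2 * of_real pi) * S a b - \<i> / (2 * of_real pi) * S a' b' + of_real c * (\<Sum>j\<in>F. a j * b j)" .
      \<comment> \<open>With \<open>1 / (2 pi) \<le> 1 / 2\<close>, the two Hilbert forms together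
        cost \<open>C * M\<close>; the diagonal adds \<open>M\<close>.\<close>
      have half: "norm (\<i> / (2 * of_real pi) * x) \<le> norm x / 2" for x
      proof -
        have "1 * norm x \<le> pi * norm x" using pi_ge_two by (intro mult_right_mono) auto
        thus ?thesis by (simp add: norm_mult norm_divide field_simps)
      qed
      have "norm (S a b) \<le> C * M" unfolding S_def M_def by (rule C(2)[OF F])
      moreover have "norm (S a' b') \<le> C * M"
      proof -
        have "fin_norm p F a' = fin_norm p F a" "fin_norm q F b' = fin_norm q F b"
          by (auto intro!: fin_norm_cong simp: a'_def b'_def norm_mult norm_power_int)
        thus ?thesis unfolding M_def S_def using C(2)[OF F, of a' b'] by simp
      qed
      moreover have "norm (of_real c * (\<Sum>j\<in>F. a j * b j)) \<le> M"
      proof -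
        have "norm (\<Sum>j\<in>F. a j * b j) \<le> (\<Sum>j\<in>F. norm (a j) * norm (b j))"
          by (rule sum_norm_le) (simp add: norm_mult)
        also have "\<dots> \<le> M" unfolding M_def by (rule Holder_finite[OF F p pq])
        finally have "\<bar>c\<bar> * norm (\<Sum>j\<in>F. a j * b j) \<le> 1 * M"
          using arc_diagonal_bound[of t] by (intro mult_mono) (auto simp: c_def)
        thus ?thesis by (simp add: norm_mult)
      qed
      ultimately show ?thesis
        unfolding ft using half[of "S a b"] half[of "S a' b'"]
          norm_triangle_ineq4[of "\<i> / (2 * of_real pi) * S a b" "\<i> / (2 * of_real pi) * S a' b'"]
          norm_triangle_ineq[of "\<i> / (2 * of_real pi) * S a b - \<i> / (2 * of_real pi) * S a' b'"
            "of_real c * (\<Sum>j\<in>F. a j * b j)"]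
        unfolding distrib_right by linarith
    qed
    have I: "(\<lambda>t. of_real (real n * t ^ (n - 1)) * arc_kernel t m * x * y) integrable_on {-1..1}" for m x y
      by (intro integrable_continuous_interval continuous_intros continuous_on_arc_kernel)
    have "integral {-1..1} (\<lambda>t. of_real (real n * t ^ (n - 1)) * f t)
      = integral {-1..1} (\<lambda>t. \<Sum>j\<in>F. \<Sum>k\<in>F. of_real (real n * t ^ (n - 1)) * arc_kernel t (j - k) * a k * b j)"
      unfolding f_def sum_distrib_left by (simp add: mult_ac)
    also have "\<dots> = (\<Sum>j\<in>F. \<Sum>k\<in>F. integral {-1..1} (\<lambda>t. of_real (real n * t ^ (n - 1)) * arc_kernel t (j - k)) * a k * b j)"
      using I F by (simp add: integral_sum integrable_sum)
    finally have eq: "(- 1) ^ n * f (- 1) + integral {-1..1} (\<lambda>t. of_real (real n * t ^ (n - 1)) * f t)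
      = (\<Sum>j\<in>F. \<Sum>k\<in>F. hardy_kernel n (j - k) * a k * b j)"
      unfolding hardy_kernel_by_parts by (simp add: f_def sum_distrib_left sum.distrib algebra_simps)
    show "norm (\<Sum>j\<in>F. \<Sum>k\<in>F. hardy_kernel n (j - k) * a k * b j) \<le> 3 * (C + 1) * (fin_norm p F a * fin_norm q F b)"
      unfolding eq[symmetric] M_def[symmetric]
      by (rule order_trans[OF norm_by_parts_le[OF contf bound]]) (simp only: mult.assoc order_refl)
  qed (use C in auto)
qed

subsection \<open>Sequence spaces and Hardy spaces\<close>

definition restrict_seq :: "'a set \<Rightarrow> ('a \<Rightarrow> complex) \<Rightarrow> 'a \<Rightarrow> complex" where
  "restrict_seq F a = (\<lambda>k. if k \<in> F then a k else 0)"

lemma lp_norm_nonneg [simp]: "lp_norm p a \<ge> 0"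
  by (simp add: lp_norm_def)

lemma fin_norm_le_lp_norm:
  assumes "p > 0" "in_lp p a" "finite F"
  shows "fin_norm p F a \<le> lp_norm p a"
  unfolding fin_norm_def lp_norm_def using assms
  by (intro powr_mono2 finite_sum_le_infsum) (auto simp: in_lp_def intro: sum_nonneg)

lemma in_lpI:
  assumes "p > 0" and M: "\<And>F. finite F \<Longrightarrow> fin_norm p F a \<le> M"
  shows "in_lp p a" "lp_norm p a \<le> M"
proof -
  have M0: "M \<ge> 0" using M[of "{}"] by (simp add: fin_norm_def)
  have S: "(\<Sum>k\<in>F. norm (a k) powr p) \<le> M powr p" if "finite F" for F
    using M[OF that] \<open>p > 0\<close> by (subst fin_norm_powr[symmetric]) (auto intro: powr_mono2)
  show *: "in_lp p a"
    unfolding in_lp_def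
    by (rule nonneg_bdd_above_summable_on) (auto intro!: bdd_aboveI[of _ "M powr p"] S)
  have "infsum (\<lambda>k. norm (a k) powr p) UNIV \<le> M powr p"
    using * unfolding in_lp_def by (rule infsum_le_finite_sums) (use S in auto)
  hence "lp_norm p a \<le> (M powr p) powr (1 / p)"
    unfolding lp_norm_def using \<open>p > 0\<close> by (intro powr_mono2) (auto intro: infsum_nonneg)
  thus "lp_norm p a \<le> M" using M0 \<open>p > 0\<close> by (simp add: powr_inverse_powr)
qed

lemma Holder_lp:
  assumes p: "1 < p" and pq: "1 / p + 1 / q = 1" and a: "in_lp p a" and b: "in_lp q b"
  shows "(\<lambda>k. norm (a k * b k)) summable_on UNIV" "(\<lambda>k. a k * b k) summable_on UNIV"
    "norm (\<Sum>\<^sub>\<infinity>k. a k * b k) \<le> lp_norm p a * lp_norm q b"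
proof -
  note c = conjugate_exponent[OF p pq]
  have S: "(\<Sum>k\<in>F. norm (a k * b k)) \<le> lp_norm p a * lp_norm q b" if "finite F" for F
  proof -
    have "(\<Sum>k\<in>F. norm (a k * b k)) \<le> fin_norm p F a * fin_norm q F b"
      using Holder_finite[OF that p pq] by (simp add: norm_mult)
    also have "\<dots> \<le> lp_norm p a * lp_norm q b"
      using p c a b that by (intro mult_mono fin_norm_le_lp_norm) auto
    finally show ?thesis .
  qed
  show *: "(\<lambda>k. norm (a k * b k)) summable_on UNIV"
    by (rule nonneg_bdd_above_summable_on) (auto intro!: bdd_aboveI[of _ "lp_norm p a * lp_norm q b"] S)
  thus "(\<lambda>k. a k * b k) summable_on UNIV" by (rule abs_summable_summable)
  have "norm (\<Sum>\<^sub>\<infinity>k. a k * b k) \<le> (\<Sum>\<^sub>\<infinity>k. norm (a k * b k))" by (rule norm_infsum_bound[OF *])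
  also have "\<dots> \<le> lp_norm p a * lp_norm q b"
    using * by (rule infsum_le_finite_sums) (use S in auto)
  finally show "norm (\<Sum>\<^sub>\<infinity>k. a k * b k) \<le> lp_norm p a * lp_norm q b" .
qed

lemma lp_cong_norm:
  assumes "\<And>k. norm (a k) = norm (b k)"
  shows "in_lp p a \<longleftrightarrow> in_lp p b" "lp_norm p a = lp_norm p b"
  using assms by (simp_all add: in_lp_def lp_norm_def)

lemma lp_reindex:
  assumes "bij g"
  shows "in_lp p (\<lambda>k. a (g k)) \<longleftrightarrow> in_lp p a" "lp_norm p (\<lambda>k. a (g k)) = lp_norm p a"
  using summable_on_reindex_bij_betw[OF assms, of "\<lambda>k. norm (a k) powr p"]
    infsum_reindex_bij_betw[OF assms, of "\<lambda>k. norm (a k) powr p"]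
  by (simp_all add: in_lp_def lp_norm_def)

lemma bij_int_affine: "bij (\<lambda>k::int. k + c)" "bij (\<lambda>k::int. k - c)" "bij (\<lambda>k::int. c - k)"
  by (rule bij_betw_byWitness[where f' = "\<lambda>k. k - c"], auto)
    (rule bij_betw_byWitness[where f' = "\<lambda>k. k + c"], auto,
      rule bij_betw_byWitness[where f' = "\<lambda>k. c - k"], auto)

lemma lp_cmult:
  assumes "in_lp p a" "p > 0"
  shows "in_lp p (\<lambda>k. c * a k)" "lp_norm p (\<lambda>k. c * a k) = norm c * lp_norm p a"
proof -
  have eq: "norm (c * a k) powr p = norm c powr p * norm (a k) powr p" for k
    by (simp add: norm_mult powr_mult)
  show "in_lp p (\<lambda>k. c * a k)"
    using assms unfolding in_lp_def eq by (intro summable_on_cmult_right)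
  have "lp_norm p (\<lambda>k. c * a k) = (norm c powr p * (\<Sum>\<^sub>\<infinity>k. norm (a k) powr p)) powr (1 / p)"
    unfolding lp_norm_def eq using assms by (subst infsum_cmult_right) (auto simp: in_lp_def)
  also have "\<dots> = (norm c powr p) powr (1 / p) * lp_norm p a"
    unfolding lp_norm_def by (simp add: powr_mult infsum_nonneg)
  finally show "lp_norm p (\<lambda>k. c * a k) = norm c * lp_norm p a"
    using assms by (simp add: powr_inverse_powr)
qed

text \<open>One factor 2 comes from splitting the \<open>p\<close>-th power of a sum, the other from
  \<open>M^p + M^p \<le> (2 M)^p\<close>. The crude constant suffices, as the lemma serves only
  closure under addition.\<close>

lemma lp_add:
  assumes p: "1 \<le> p" and a: "in_lp p a" "lp_norm p a \<le> M" and b: "in_lp p b" "lp_norm p b \<le> M"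
  shows "in_lp p (\<lambda>k. a k + b k)" "lp_norm p (\<lambda>k. a k + b k) \<le> 4 * M"
proof -
  have M0: "M \<ge> 0" using a(2) lp_norm_nonneg order_trans by blast
  have p0: "p > 0" using p by simp
  have fin: "fin_norm p F (\<lambda>k. a k + b k) \<le> 4 * M" if "finite F" for F
  proof -
    have A: "(\<Sum>k\<in>F. norm (x k) powr p) \<le> M powr p" if "in_lp p x" "lp_norm p x \<le> M" for x
    proof -
      have "fin_norm p F x powr p \<le> M powr p"
        using fin_norm_le_lp_norm[OF p0 that(1) \<open>finite F\<close>] that(2) p by (intro powr_mono2) auto
      thus ?thesis using p0 by (simp add: fin_norm_powr)
    qed
    have "(\<Sum>k\<in>F. norm (a k + b k) powr p) \<le> (\<Sum>k\<in>F. 2 powr p * (norm (a k) powr p + norm (b k) powr p))"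
    proof (rule sum_mono)
      fix k
      have "norm (a k + b k) powr p \<le> (norm (a k) + norm (b k)) powr p"
        using p by (intro powr_mono2 norm_triangle_ineq) auto
      also have "\<dots> \<le> 2 powr p * (norm (a k) powr p + norm (b k) powr p)"
        using p by (intro powr_add_le) auto
      finally show "norm (a k + b k) powr p \<le> 2 powr p * (norm (a k) powr p + norm (b k) powr p)" .
    qed
    also have "\<dots> = 2 powr p * ((\<Sum>k\<in>F. norm (a k) powr p) + (\<Sum>k\<in>F. norm (b k) powr p))"
      by (simp add: sum_distrib_left[symmetric] sum.distrib)
    also have "\<dots> \<le> 2 powr p * (M powr p + M powr p)"
      using A a b by (intro mult_left_mono add_mono) auto
    also have "\<dots> \<le> 2 powr p * (2 powr p * M powr p)"
      using powr_mono[OF p, of 2] by (intro mult_left_mono) (auto simp: mult_right_mono)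
    also have "\<dots> = (2 * (2 * M)) powr p" using M0 by (simp only: powr_mult zero_le_numeral mult_nonneg_nonneg)
    also have "2 * (2 * M) = 4 * M" by simp
    finally have "fin_norm p F (\<lambda>k. a k + b k) \<le> ((4 * M) powr p) powr (1 / p)"
      unfolding fin_norm_def using p by (intro powr_mono2) (auto intro: sum_nonneg)
    thus ?thesis using M0 p0 by (simp add: powr_inverse_powr)
  qed
  show "in_lp p (\<lambda>k. a k + b k)" "lp_norm p (\<lambda>k. a k + b k) \<le> 4 * M"
    using in_lpI[OF p0 fin] by auto
qed

lemma in_lp_finite_support:
  assumes "p > 0" "finite F"
  shows "in_lp p (restrict_seq F a)" "lp_norm p (restrict_seq F a) = fin_norm p F a"
proof -
  have "(\<lambda>k. norm (restrict_seq F a k) powr p) summable_on UNIV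
      \<longleftrightarrow> (\<lambda>k. norm (a k) powr p) summable_on F"
    using assms by (intro summable_on_cong_neutral) (auto simp: restrict_seq_def)
  thus "in_lp p (restrict_seq F a)" using assms by (simp add: in_lp_def)
  have "infsum (\<lambda>k. norm (restrict_seq F a k) powr p) UNIV = infsum (\<lambda>k. norm (a k) powr p) F"
    using assms by (intro infsum_cong_neutral) (auto simp: restrict_seq_def)
  thus "lp_norm p (restrict_seq F a) = fin_norm p F a"
    using assms by (simp add: lp_norm_def fin_norm_def)
qed

lemma lp_tail:
  assumes "p > 0" "in_lp p a"
  shows "in_lp p (restrict_seq (- F) a)"
    and "((\<lambda>F. lp_norm p (restrict_seq (- F) a)) \<longlongrightarrow> 0) (finite_subsets_at_top UNIV)"
proof -
  let ?f = "\<lambda>k. norm (a k) powr p"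
  have f: "?f summable_on UNIV" using assms by (simp add: in_lp_def)
  have 1: "(\<lambda>k. norm (restrict_seq (- F) a k) powr p) summable_on UNIV \<longleftrightarrow> ?f summable_on (- F)" for F
    using assms by (intro summable_on_cong_neutral) (auto simp: restrict_seq_def)
  show "in_lp p (restrict_seq (- F) a)"
    unfolding in_lp_def 1 using f by (rule summable_on_subset_banach) auto
  have 2: "lp_norm p (restrict_seq (- F) a) = (infsum ?f UNIV - sum ?f F) powr (1 / p)" if "finite F" for F
  proof -
    have "infsum (\<lambda>k. norm (restrict_seq (- F) a k) powr p) UNIV = infsum ?f (UNIV - F)"
      using assms by (intro infsum_cong_neutral) (auto simp: restrict_seq_def)
    also have "\<dots> = infsum ?f UNIV - infsum ?f F"
      using f that by (intro infsum_Diff) auto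
    finally show ?thesis using that by (simp add: lp_norm_def)
  qed
  have "((\<lambda>F. infsum ?f UNIV - sum ?f F) \<longlongrightarrow> infsum ?f UNIV - infsum ?f UNIV) (finite_subsets_at_top UNIV)"
    by (intro tendsto_intros infsum_tendsto f)
  hence "((\<lambda>F. (infsum ?f UNIV - sum ?f F) powr (1 / p)) \<longlongrightarrow> 0) (finite_subsets_at_top UNIV)"
    using assms by (intro tendsto_zero_powrI[where b = "1 / p"]) (auto intro!: eventually_finite_subsets_at_top_weakI finite_sum_le_infsum f)
  thus "((\<lambda>F. lp_norm p (restrict_seq (- F) a)) \<longlongrightarrow> 0) (finite_subsets_at_top UNIV)"
    by (rule Lim_transform_eventually) (auto intro!: eventually_finite_subsets_at_top_weakI simp: 2)
qed

definition unit_seq :: "'a \<Rightarrow> 'a \<Rightarrow> complex" where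
  "unit_seq k = (\<lambda>j. if j = k then 1 else 0)"

lemma in_lp_unit_seq: "p > 0 \<Longrightarrow> in_lp p (unit_seq k)"
  using in_lp_finite_support(1)[of p "{k}" "\<lambda>_. 1"]
  by (simp add: restrict_seq_def unit_seq_def)

text \<open>Finitely supported sequences are dense: linearity gives the value on a finite section,
  and the tail tends to 0 in norm. It is applied both to functionals pulled back from
  \<open>H^p\<close> and to the pairing as a function of its second argument.\<close>

lemma bounded_functional_has_sum:
  fixes L :: "(int \<Rightarrow> complex) \<Rightarrow> complex"
  assumes p: "1 \<le> p" and a: "in_lp p a"
    and add: "\<And>x y. in_lp p x \<Longrightarrow> in_lp p y \<Longrightarrow> L (\<lambda>k. x k + y k) = L x + L y"
    and scale: "\<And>c x. in_lp p x \<Longrightarrow> L (\<lambda>k. c * x k) = c * L x"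
    and bound: "\<And>x. in_lp p x \<Longrightarrow> norm (L x) \<le> M * lp_norm p x"
  shows "((\<lambda>k. a k * L (unit_seq k)) has_sum L a) UNIV"
    and "finite F \<Longrightarrow> L (restrict_seq F a) = (\<Sum>k\<in>F. a k * L (unit_seq k))"
proof -
  have p0: "p > 0" using p by simp
  have fin: "L (restrict_seq F a) = (\<Sum>k\<in>F. a k * L (unit_seq k))" if "finite F" for F
    using that
  proof (induction F rule: finite_induct)
    case empty
    \<comment> \<open>The zero sequence is written as a multiple of a unit sequence, so that
      homogeneity yields \<open>L 0 = 0\<close>.\<close>
    have "restrict_seq {} a = (\<lambda>k. 0 * unit_seq 0 k)" by (simp add: restrict_seq_def)
    thus ?case using scale[OF in_lp_unit_seq[OF p0], of 0 0] by simp
  next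
    case (insert k F)
    have "restrict_seq (insert k F) a = (\<lambda>j. restrict_seq F a j + a k * unit_seq k j)"
      using insert by (auto simp: restrict_seq_def unit_seq_def)
    thus ?case
      using insert in_lp_finite_support(1)[OF p0 insert(1)] lp_cmult(1)[OF in_lp_unit_seq p0] p0
      by (simp add: add scale in_lp_unit_seq)
  qed
  thus "finite F \<Longrightarrow> L (restrict_seq F a) = (\<Sum>k\<in>F. a k * L (unit_seq k))" .
  have split: "L a = L (restrict_seq F a) + L (restrict_seq (- F) a)" if "finite F" for F
  proof -
    have "a = (\<lambda>k. restrict_seq F a k + restrict_seq (- F) a k)" by (auto simp: restrict_seq_def)
    hence "L a = L (\<lambda>k. restrict_seq F a k + restrict_seq (- F) a k)" by (rule arg_cong)
    also have "\<dots> = L (restrict_seq F a) + L (restrict_seq (- F) a)"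
      by (intro add in_lp_finite_support(1) lp_tail(1) p0 that a)
    finally show ?thesis .
  qed
  have "((\<lambda>F. L (restrict_seq (- F) a)) \<longlongrightarrow> 0) (finite_subsets_at_top UNIV)"
  proof (rule Lim_null_comparison)
    show "\<forall>\<^sub>F F in finite_subsets_at_top UNIV. norm (L (restrict_seq (- F) a)) \<le> M * lp_norm p (restrict_seq (- F) a)"
      by (intro always_eventually allI bound lp_tail(1) p0 a)
    show "((\<lambda>F. M * lp_norm p (restrict_seq (- F) a)) \<longlongrightarrow> 0) (finite_subsets_at_top UNIV)"
      using tendsto_mult_left[OF lp_tail(2)[OF p0 a], of M] by simp
  qed
  hence "((\<lambda>F. L a - L (restrict_seq (- F) a)) \<longlongrightarrow> L a - 0) (finite_subsets_at_top UNIV)"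
    by (intro tendsto_intros)
  hence "((\<lambda>F. L a - L (restrict_seq (- F) a)) \<longlongrightarrow> L a) (finite_subsets_at_top UNIV)" by simp
  moreover have "L a - L (restrict_seq (- F) a) = (\<Sum>k\<in>F. a k * L (unit_seq k))" if "finite F" for F
    using split[OF that] fin[OF that] by simp
  ultimately show "((\<lambda>k. a k * L (unit_seq k)) has_sum L a) UNIV"
    unfolding has_sum_def
    by (rule Lim_transform_eventually[OF _ eventually_finite_subsets_at_top_weakI])
qed

section \<open>Linear structure and uniqueness in the Hardy space\<close>

lemma Hp_level:
  assumes "f \<in> Hp p"
  shows "in_lp p (level f n)" "lp_norm p (level f n) \<le> Hp_norm p f" "discrete_hol f"
  using assms by (auto simp: Hp_def Hp_norm_def intro: cSUP_upper)

lemma HpI: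
  assumes "discrete_hol f" "\<And>n. in_lp p (level f n)" "\<And>n. lp_norm p (level f n) \<le> M"
  shows "f \<in> Hp p" "Hp_norm p f \<le> M"
  using assms by (auto simp: Hp_def Hp_norm_def intro!: cSUP_least bdd_aboveI[of _ M])

lemma Hp_norm_nonneg: "f \<in> Hp p \<Longrightarrow> Hp_norm p f \<ge> 0"
  using Hp_level(2)[of f p 0] lp_norm_nonneg[of p "level f 0"] by linarith

lemma Hp_add:
  assumes "1 \<le> p" "f \<in> Hp p" "g \<in> Hp p"
  shows "(\<lambda>z. f z + g z) \<in> Hp p"
proof (rule HpI)
  have "f (m, n) + g (m, n) + \<i> * (f (m + 1, n) + g (m + 1, n)) - (f (m + 1, n + 1) + g (m + 1, n + 1))
      - \<i> * (f (m, n + 1) + g (m, n + 1)) =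
    (f (m, n) + \<i> * f (m + 1, n) - f (m + 1, n + 1) - \<i> * f (m, n + 1))
    + (g (m, n) + \<i> * g (m + 1, n) - g (m + 1, n + 1) - \<i> * g (m, n + 1))" for m n
    by (simp add: algebra_simps)
  moreover have "f (m, n) + \<i> * f (m + 1, n) - f (m + 1, n + 1) - \<i> * f (m, n + 1) = 0"
    "g (m, n) + \<i> * g (m + 1, n) - g (m + 1, n + 1) - \<i> * g (m, n + 1) = 0" for m n
    using Hp_level(3)[OF assms(2)] Hp_level(3)[OF assms(3)] unfolding discrete_hol_def by blast+
  ultimately show "discrete_hol (\<lambda>z. f z + g z)"
    unfolding discrete_hol_def by (simp only: add_0_right simp_thms)
  fix n
  have eq: "level (\<lambda>z. f z + g z) n = (\<lambda>m. level f n m + level g n m)" by (simp add: level_def)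
  have M: "lp_norm p (level f n) \<le> max (Hp_norm p f) (Hp_norm p g)"
    "lp_norm p (level g n) \<le> max (Hp_norm p f) (Hp_norm p g)"
    using Hp_level(2)[OF assms(2), of n] Hp_level(2)[OF assms(3), of n] by auto
  show "in_lp p (level (\<lambda>z. f z + g z) n)"
    "lp_norm p (level (\<lambda>z. f z + g z) n) \<le> 4 * max (Hp_norm p f) (Hp_norm p g)"
    unfolding eq
    using lp_add[OF assms(1) Hp_level(1)[OF assms(2)] M(1) Hp_level(1)[OF assms(3)] M(2)] by auto
qed

lemma Hp_cmult:
  assumes "p > 0" "f \<in> Hp p"
  shows "(\<lambda>z. c * f z) \<in> Hp p" "Hp_norm p (\<lambda>z. c * f z) \<le> norm c * Hp_norm p f"
proof -
  have "c * f (m, n) + \<i> * (c * f (m + 1, n)) - c * f (m + 1, n + 1) - \<i> * (c * f (m, n + 1))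
      = c * (f (m, n) + \<i> * f (m + 1, n) - f (m + 1, n + 1) - \<i> * f (m, n + 1))" for m n
    by (simp add: algebra_simps)
  hence 1: "discrete_hol (\<lambda>z. c * f z)"
    using Hp_level(3)[OF assms(2)] unfolding discrete_hol_def by simp
  have eq: "level (\<lambda>z. c * f z) n = (\<lambda>m. c * level f n m)" for n by (simp add: level_def)
  have 2: "in_lp p (level (\<lambda>z. c * f z) n)" "lp_norm p (level (\<lambda>z. c * f z) n) \<le> norm c * Hp_norm p f" for n
    unfolding eq using lp_cmult[OF Hp_level(1)[OF assms(2)] assms(1), of c n] Hp_level(2)[OF assms(2), of n]
    by (auto intro: mult_left_mono)
  show "(\<lambda>z. c * f z) \<in> Hp p" "Hp_norm p (\<lambda>z. c * f z) \<le> norm c * Hp_norm p f"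
    using HpI[OF 1 2] by auto
qed

text \<open>Above a vanishing level the equation reads \<open>u (k + 1) = - i u k\<close>. The
  modulus is then constant along the next level, and summability forces it to be 0.\<close>

lemma Hp_unique:
  assumes p: "1 \<le> p" and f: "f \<in> Hp p" and h: "h \<in> Hp p" and eq: "\<And>m. f (m, 0) = h (m, 0)"
  shows "f = h"
proof -
  have p0: "p > 0" using p by simp
  define u where "u = (\<lambda>z. f z + (- 1) * h z)"
  have u: "u \<in> Hp p" unfolding u_def by (intro Hp_add p f Hp_cmult(1) p0 h)
  have "u (m, n) = 0" for m n
  proof (induction n arbitrary: m)
    case 0
    show ?case using eq[of m] by (simp add: u_def)
  next
    case (Suc n)
    have "u (k + 1, Suc n) = - \<i> * u (k, Suc n)" for k
    proof -
      have "u (k, n) + \<i> * u (k + 1, n) - u (k + 1, n + 1) - \<i> * u (k, n + 1) = 0"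
        using Hp_level(3)[OF u] unfolding discrete_hol_def by blast
      hence "- (u (k + 1, Suc n) + \<i> * u (k, Suc n)) = 0" by (simp add: Suc)
      hence "u (k + 1, Suc n) + \<i> * u (k, Suc n) = 0" by (simp only: neg_equal_0_iff_equal)
      thus ?thesis by (simp add: eq_neg_iff_add_eq_0)
    qed
    hence step: "norm (u (k + 1, Suc n)) = norm (u (k, Suc n))" for k by (simp add: norm_mult)
    have const: "norm (u (k, Suc n)) = norm (u (m, Suc n))" for k
    proof (induction k rule: int_induct[where k = m])
      case (step1 i) thus ?case using step[of i] by simp
    next
      case (step2 i) thus ?case using step[of "i - 1"] by simp
    qed simp
    have "(\<lambda>k. norm (u (k, Suc n)) powr p) summable_on UNIV"
      using Hp_level(1)[OF u, of "Suc n"] by (simp add: in_lp_def level_def)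
    moreover have "(\<lambda>k. norm (u (k, Suc n)) powr p) = (\<lambda>k. norm (u (m, Suc n)) powr p)"
      by (rule ext) (rule arg_cong[OF const])
    ultimately have "(\<lambda>k::int. norm (u (m, Suc n)) powr p) summable_on UNIV" by (rule back_subst)
    hence "norm (u (m, Suc n)) powr p = 0"
      by (rule contrapos_pp) (rule infsum_diverge_constant[OF infinite_UNIV_int])
    thus ?case by simp
  qed
  thus ?thesis by (auto simp: u_def)
qed

subsection \<open>The Cauchy integral of an lp sequence\<close>

lemma in_lp_hardy_kernel:
  assumes "1 < q"
  shows "in_lp q (hardy_kernel n)"
    and "in_lp q (\<lambda>k. hardy_kernel n (k - m))" and "in_lp q (\<lambda>k. hardy_kernel n (m - k))"
    and "in_lp q (\<lambda>k. hardy_kernel n (k + m))"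
proof -
  have "(\<lambda>m::int. 6 powr q * (1 + \<bar>of_int m\<bar>) powr (- q)) summable_on UNIV"
    using assms by (intro summable_on_cmult_right summable_on_int_powr)
  thus *: "in_lp q (hardy_kernel n)"
    unfolding in_lp_def
  proof (rule summable_on_comparison_test)
    fix m :: int
    have "norm (hardy_kernel n m) powr q \<le> (6 / (1 + \<bar>of_int m\<bar>)) powr q"
      using assms norm_hardy_kernel_le by (intro powr_mono2) auto
    also have "\<dots> = 6 powr q * (1 + \<bar>of_int m\<bar>) powr (- q)"
      by (simp add: powr_divide powr_minus_divide)
    finally show "norm (hardy_kernel n m) powr q \<le> 6 powr q * (1 + \<bar>of_int m\<bar>) powr (- q)" .
  qed simp
  show "in_lp q (\<lambda>k. hardy_kernel n (k - m))" "in_lp q (\<lambda>k. hardy_kernel n (m - k))"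
    "in_lp q (\<lambda>k. hardy_kernel n (k + m))"
    using * by (simp_all add: lp_reindex(1)[OF bij_int_affine(1), where a = "hardy_kernel n"]
      lp_reindex(1)[OF bij_int_affine(2), where a = "hardy_kernel n"]
      lp_reindex(1)[OF bij_int_affine(3), where a = "hardy_kernel n"])
qed

lemma lp_norm_hardy_kernel_tendsto_0:
  assumes "1 < q"
  shows "(\<lambda>n. lp_norm q (hardy_kernel n)) \<longlonglongrightarrow> 0"
proof -
  \<comment> \<open>The exponent \<open>q\<close> is split as \<open>e + (q - e)\<close>: the power
    \<open>e\<close> of the height bound yields decay in \<open>n\<close>, while
    \<open>q - e > 1\<close> keeps the decay in \<open>m\<close> summable.\<close>
  define e where "e = (q - 1) / 2"
  have e: "e > 0" "q - e > 1" using assms by (auto simp: e_def field_simps)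
  define Z where "Z = 6 powr (q - e) * (\<Sum>\<^sub>\<infinity>m::int. (1 + \<bar>of_int m\<bar>) powr (- (q - e)))"
  have Zs: "(\<lambda>m::int. 6 powr (q - e) * (1 + \<bar>of_int m\<bar>) powr (- (q - e))) summable_on UNIV"
    using e by (intro summable_on_cmult_right summable_on_int_powr)
  have le: "lp_norm q (hardy_kernel n) \<le> (real (Suc n) powr (- e) * Z) powr (1 / q)" for n
  proof -
    have pt: "norm (hardy_kernel n m) powr q
        \<le> real (Suc n) powr (- e) * (6 powr (q - e) * (1 + \<bar>of_int m\<bar>) powr (- (q - e)))" for m
    proof -
      have "norm (hardy_kernel n m) powr q = norm (hardy_kernel n m) powr e * norm (hardy_kernel n m) powr (q - e)"
        by (simp flip: powr_add)
      also have "\<dots> \<le> (1 / (real n + 1)) powr e * (6 / (1 + \<bar>of_int m\<bar>)) powr (q - e)"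
        using e norm_hardy_kernel_le norm_hardy_kernel_le_height
        by (intro mult_mono powr_mono2) auto
      also have "(1 / (real n + 1)) powr e = real (Suc n) powr (- e)"
        by (simp add: powr_divide powr_minus_divide add.commute)
      also have "(6 / (1 + \<bar>of_int m\<bar>)) powr (q - e) = 6 powr (q - e) * (1 + \<bar>of_int m\<bar>) powr (- (q - e))"
        by (subst powr_minus_divide) (simp add: powr_divide)
      finally show ?thesis .
    qed
    have "(\<Sum>\<^sub>\<infinity>m. norm (hardy_kernel n m) powr q)
        \<le> (\<Sum>\<^sub>\<infinity>m::int. real (Suc n) powr (- e) * (6 powr (q - e) * (1 + \<bar>of_int m\<bar>) powr (- (q - e))))"
      using in_lp_hardy_kernel(1)[OF assms] pt unfolding in_lp_def
      by (intro infsum_mono summable_on_cmult_right Zs[THEN summable_on_cmult_right]) auto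
    also have "\<dots> = real (Suc n) powr (- e) * Z"
      unfolding Z_def by (simp add: infsum_cmult_right')
    finally show ?thesis
      unfolding lp_norm_def using assms by (intro powr_mono2) (auto intro: infsum_nonneg)
  qed
  have "(\<lambda>n. real n powr (- e)) \<longlonglongrightarrow> 0"
    using e by (intro tendsto_neg_powr filterlim_real_sequentially) auto
  hence "(\<lambda>n. real (Suc n) powr (- e) * Z) \<longlonglongrightarrow> 0 * Z"
    by (intro tendsto_intros LIMSEQ_Suc)
  hence lim: "(\<lambda>n. (real (Suc n) powr (- e) * Z) powr (1 / q)) \<longlonglongrightarrow> 0"
    using assms unfolding mult_zero_left
    by (intro tendsto_zero_powrI[where b = "1 / q"]) (auto simp: Z_def intro!: always_eventually mult_nonneg_nonneg infsum_nonneg)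
  show ?thesis
    by (rule Lim_null_comparison[OF _ lim]) (simp add: le del: of_nat_Suc)
qed

text \<open>Projection and extension in one formula: level 0 is the half-circle projection of
  \<open>a\<close>, and level \<open>n\<close> multiplies its spectrum by
  \<open>w^n\<close>.\<close>

definition hardy_ext :: "(int \<Rightarrow> complex) \<Rightarrow> half_lattice \<Rightarrow> complex" where
  "hardy_ext a = (\<lambda>(m, n). \<Sum>\<^sub>\<infinity>k. hardy_kernel n (m - k) * a k)"

context
  fixes p q :: real
  assumes p: "1 < p" and pq: "1 / p + 1 / q = 1"
begin

private lemma p0: "p > 0" and p1: "1 \<le> p"
  using p by auto

private lemmas q1 = conjugate_exponent(1)[OF p pq]
private lemmas qp = conjugate_exponent(4)[OF p pq]

lemma hardy_ext_summable:
  "in_lp p a \<Longrightarrow> (\<lambda>k. hardy_kernel n (m - k) * a k) summable_on UNIV"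
  by (rule Holder_lp(2)[OF q1 qp in_lp_hardy_kernel(3)[OF q1]])

lemma hardy_ext_add:
  "in_lp p a \<Longrightarrow> in_lp p b \<Longrightarrow> hardy_ext (\<lambda>k. a k + b k) = (\<lambda>z. hardy_ext a z + hardy_ext b z)"
  by (auto simp: hardy_ext_def distrib_left infsum_add hardy_ext_summable)

lemma hardy_ext_cmult: "hardy_ext (\<lambda>k. c * a k) = (\<lambda>z. c * hardy_ext a z)"
proof -
  have "hardy_kernel n (m - k) * (c * a k) = c * (hardy_kernel n (m - k) * a k)" for n m k
    by (simp only: mult.left_commute)
  hence "hardy_ext (\<lambda>k. c * a k) (m, n) = c * hardy_ext a (m, n)" for m n
    by (simp only: hardy_ext_def prod.case infsum_cmult_right')
  thus ?thesis by auto
qed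

lemma hardy_ext_unit_seq: "hardy_ext (unit_seq k) (m, n) = hardy_kernel n (m - k)"
proof -
  have "(\<Sum>\<^sub>\<infinity>j. hardy_kernel n (m - j) * unit_seq k j) = (\<Sum>\<^sub>\<infinity>j\<in>{k}. hardy_kernel n (m - j))"
    by (intro infsum_cong_neutral) (auto simp: unit_seq_def)
  thus ?thesis by (simp add: hardy_ext_def)
qed

lemma discrete_hol_hardy_ext:
  assumes "in_lp p a"
  shows "discrete_hol (hardy_ext a)"
  unfolding discrete_hol_def
proof (intro allI)
  fix m :: int and n :: nat
  let ?t = "\<lambda>m n k. hardy_kernel n (m - k) * a k"
  have s: "?t m n summable_on UNIV" for m n by (rule hardy_ext_summable[OF assms])
  have "?t m n k + \<i> * ?t (m + 1) n k = ?t (m + 1) (n + 1) k + \<i> * ?t m (n + 1) k" for k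
  proof -
    have "m + 1 - k = m - k + 1" by simp
    hence "hardy_kernel n (m - k) + \<i> * hardy_kernel n (m + 1 - k)
        = hardy_kernel (n + 1) (m + 1 - k) + \<i> * hardy_kernel (n + 1) (m - k)"
      using hardy_kernel_discrete_hol[of n "m - k"] by (simp only: \<open>m + 1 - k = m - k + 1\<close> Suc_eq_plus1)
    from arg_cong[OF this, of "\<lambda>z. z * a k"] show ?thesis by (simp add: algebra_simps)
  qed
  hence "(\<Sum>\<^sub>\<infinity>k. ?t m n k + \<i> * ?t (m + 1) n k) = (\<Sum>\<^sub>\<infinity>k. ?t (m + 1) (n + 1) k + \<i> * ?t m (n + 1) k)"
    by presburger
  hence "infsum (?t m n) UNIV + \<i> * infsum (?t (m + 1) n) UNIV
      = infsum (?t (m + 1) (n + 1)) UNIV + \<i> * infsum (?t m (n + 1)) UNIV"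
    by (simp only: infsum_add[OF s summable_on_cmult_right[OF s]] infsum_cmult_right')
  thus "hardy_ext a (m, n) + \<i> * hardy_ext a (m + 1, n) - hardy_ext a (m + 1, n + 1)
      - \<i> * hardy_ext a (m, n + 1) = 0"
    by (simp add: hardy_ext_def)
qed

text \<open>By the converse of Hoelder's inequality it suffices to test finite sections of a level
  against finite sequences; the form bound, uniform in \<open>n\<close> and in the finite set, then
  passes to the limit.\<close>

lemma hardy_ext_bounded:
  obtains C where "C \<ge> 0"
    "\<And>a. in_lp p a \<Longrightarrow> hardy_ext a \<in> Hp p"
    "\<And>a. in_lp p a \<Longrightarrow> Hp_norm p (hardy_ext a) \<le> C * lp_norm p a"
proof -
  obtain C where C: "C \<ge> 0" "\<And>n F a b. finite F \<Longrightarrow>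
    norm (\<Sum>j\<in>F. \<Sum>k\<in>F. hardy_kernel n (j - k) * a k * b j) \<le> C * (fin_norm p F a * fin_norm q F b)"
    by (rule hardy_kernel_form_bounded[OF p pq]) blast
  have fin: "fin_norm p J (level (hardy_ext a) n) \<le> C * lp_norm p a" if a: "in_lp p a" and J: "finite J" for a n J
  proof (rule converse_Holder_finite[OF J p pq])
    show "C * lp_norm p a \<ge> 0" using C by simp
    fix b :: "int \<Rightarrow> complex"
    let ?T = "\<lambda>F. \<Sum>j\<in>J. b j * (\<Sum>k\<in>F. hardy_kernel n (j - k) * a k)"
    have "(?T \<longlongrightarrow> (\<Sum>j\<in>J. b j * (\<Sum>\<^sub>\<infinity>k. hardy_kernel n (j - k) * a k))) (finite_subsets_at_top UNIV)"
      by (intro tendsto_intros infsum_tendsto hardy_ext_summable a)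
    hence lim: "(?T \<longlongrightarrow> (\<Sum>j\<in>J. b j * level (hardy_ext a) n j)) (finite_subsets_at_top UNIV)"
      by (simp add: level_def hardy_ext_def)
    \<comment> \<open>The form bound uses one index set for both variables, so \<open>b\<close> is
      extended by zero from \<open>J\<close> to the larger \<open>F\<close>.\<close>
    have "norm (?T F) \<le> C * lp_norm p a * fin_norm q J b" if F: "finite F" "J \<subseteq> F" for F
    proof -
      have "?T F = (\<Sum>j\<in>J. \<Sum>k\<in>F. hardy_kernel n (j - k) * a k * restrict_seq J b j)"
        by (simp add: sum_distrib_left restrict_seq_def mult_ac)
      also have "\<dots> = (\<Sum>j\<in>F. \<Sum>k\<in>F. hardy_kernel n (j - k) * a k * restrict_seq J b j)"
        using F by (intro sum.mono_neutral_left) (auto simp: restrict_seq_def)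
      also have "norm \<dots> \<le> C * (fin_norm p F a * fin_norm q F (restrict_seq J b))" by (rule C(2)[OF F(1)])
      also have "fin_norm q F (restrict_seq J b) = fin_norm q J b"
      proof -
        have "(\<Sum>k\<in>F. norm (restrict_seq J b k) powr q) = (\<Sum>k\<in>J. norm (b k) powr q)"
          using F q1 by (intro sum.mono_neutral_cong_right) (auto simp: restrict_seq_def)
        thus ?thesis by (simp add: fin_norm_def)
      qed
      also have "C * (fin_norm p F a * fin_norm q J b) \<le> C * (lp_norm p a * fin_norm q J b)"
        using C(1) p0 a F by (intro mult_left_mono mult_right_mono fin_norm_le_lp_norm) auto
      finally show ?thesis by (simp add: mult_ac)
    qed
    hence "\<forall>\<^sub>F F in finite_subsets_at_top UNIV. norm (?T F) \<le> C * lp_norm p a * fin_norm q J b"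
      using J by (auto simp: eventually_finite_subsets_at_top)
    thus "norm (\<Sum>j\<in>J. b j * level (hardy_ext a) n j) \<le> C * lp_norm p a * fin_norm q J b"
      by (intro tendsto_upperbound[OF tendsto_norm[OF lim]]) auto
  qed
  show ?thesis
  proof (rule that[OF C(1)])
    fix a assume a: "in_lp p a"
    note L = in_lpI[OF p0 fin[OF a]]
    show "hardy_ext a \<in> Hp p" "Hp_norm p (hardy_ext a) \<le> C * lp_norm p a"
      using HpI[OF discrete_hol_hardy_ext[OF a] L] by auto
  qed
qed

lemma hardy_ext_unit_in_Hp: "hardy_ext (unit_seq k) \<in> Hp p"
  by (rule hardy_ext_bounded) (use in_lp_unit_seq[OF p0] in blast)

section \<open>Vanishing of the complementary part and reproduction\<close>

lemma summable_level_hardy_kernel: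
  "f \<in> Hp p \<Longrightarrow> (\<lambda>k. hardy_kernel l (k - m) * f (k, n)) summable_on UNIV"
  using Holder_lp(2)[OF q1 qp in_lp_hardy_kernel(2)[OF q1] Hp_level(1)] by (simp add: level_def)

lemma infsum_shift_int: "(\<Sum>\<^sub>\<infinity>k::int. h (k + 1)) = (\<Sum>\<^sub>\<infinity>k. h k)"
  by (rule infsum_reindex_bij_betw[OF bij_int_affine(1)])

lemma summable_shift_int: "(\<lambda>k::int. h (k + 1)) summable_on UNIV \<longleftrightarrow> h summable_on UNIV"
  by (rule summable_on_reindex_bij_betw[OF bij_int_affine(1)])

text \<open>A discrete Cauchy theorem. The reflected kernel belongs to the complementary half circle; \<open>u\<close> below is
  a sequence from which the transposes of the two sides of the equation of discrete holomorphy produce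
  the reflected kernels of two consecutive levels.\<close>

lemma reflected_kernel_sum_step:
  assumes f: "f \<in> Hp p"
  shows "(\<Sum>\<^sub>\<infinity>k. hardy_kernel n (k - m) * f (k, n))
    = (\<Sum>\<^sub>\<infinity>k. hardy_kernel (Suc n) (k - m) * f (k, Suc n))"
proof -
  \<comment> \<open>\<open>K1\<close> and \<open>K2\<close> are two linear equations for
    \<open>u k\<close> and \<open>u (k + 1)\<close>. Solving them for \<open>u (k + 1)\<close>
    forces this formula, and discrete holomorphy of the kernel makes it consistent with the value at
    \<open>k\<close>.\<close>
  define u where "u = (\<lambda>k. (hardy_kernel n (k - m) - \<i> * hardy_kernel (Suc n) (k - m)) / 2)"
  have hol: "hardy_kernel n (k - m) + \<i> * hardy_kernel n (k + 1 - m)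
      = hardy_kernel (Suc n) (k + 1 - m) + \<i> * hardy_kernel (Suc n) (k - m)" for k
    using hardy_kernel_discrete_hol[of n "k - m"] by (simp add: algebra_simps)
  have K1: "u (k + 1) + \<i> * u k = hardy_kernel n (k + 1 - m)" for k
    using arg_cong[OF hol[of k], of "\<lambda>z. \<i> * z"] by (simp add: u_def field_simps)
  have K2: "u k + \<i> * u (k + 1) = hardy_kernel (Suc n) (k + 1 - m)" for k
  proof -
    have "u k + \<i> * u (k + 1) = ((hardy_kernel n (k - m) + \<i> * hardy_kernel n (k + 1 - m))
        - \<i> * hardy_kernel (Suc n) (k - m) + hardy_kernel (Suc n) (k + 1 - m)) / 2"
      by (simp add: u_def field_simps)
    thus ?thesis unfolding hol by simp
  qed
  have su: "(\<lambda>k. u k * f (k, l)) summable_on UNIV" for l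
  proof -
    have "(\<lambda>k. 1 / 2 * (hardy_kernel n (k - m) * f (k, l)) + (- \<i> / 2) * (hardy_kernel (Suc n) (k - m) * f (k, l))) summable_on UNIV"
      by (intro summable_on_add summable_on_cmult_right summable_level_hardy_kernel f)
    thus ?thesis by (simp add: u_def field_simps)
  qed
  have su': "(\<lambda>k. u k * f (k + 1, l)) summable_on UNIV" for l
  proof -
    have s: "(\<lambda>k. hardy_kernel n' (k - m) * f (k + 1, l)) summable_on UNIV" for n'
      using summable_level_hardy_kernel[OF f, of n' "m + 1" l]
      by (subst (asm) summable_shift_int[symmetric]) simp
    have "(\<lambda>k. 1 / 2 * (hardy_kernel n (k - m) * f (k + 1, l)) + (- \<i> / 2) * (hardy_kernel (Suc n) (k - m) * f (k + 1, l))) summable_on UNIV"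
      by (intro summable_on_add summable_on_cmult_right s)
    thus ?thesis by (simp add: u_def field_simps)
  qed
  have su1: "(\<lambda>k. u (k + 1) * f (k + 1, l)) summable_on UNIV" for l
    using su[of l] by (subst (asm) summable_shift_int[symmetric])
  have sh: "(\<Sum>\<^sub>\<infinity>k. u (k + 1) * f (k + 1, l)) = (\<Sum>\<^sub>\<infinity>k. u k * f (k, l))" for l
    by (rule infsum_shift_int[of "\<lambda>k. u k * f (k, l)"])
  have "(\<Sum>\<^sub>\<infinity>k. hardy_kernel n (k - m) * f (k, n)) = (\<Sum>\<^sub>\<infinity>k. hardy_kernel n (k + 1 - m) * f (k + 1, n))"
    by (rule infsum_shift_int[symmetric])
  also have "\<dots> = (\<Sum>\<^sub>\<infinity>k. u (k + 1) * f (k + 1, n) + \<i> * (u k * f (k + 1, n)))"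
    by (simp add: K1[symmetric] algebra_simps)
  also have "\<dots> = (\<Sum>\<^sub>\<infinity>k. u k * f (k, n)) + \<i> * (\<Sum>\<^sub>\<infinity>k. u k * f (k + 1, n))"
    by (subst infsum_add[OF su1 summable_on_cmult_right[OF su']]) (simp add: sh infsum_cmult_right')
  also have "\<dots> = (\<Sum>\<^sub>\<infinity>k. u k * f (k, n) + \<i> * (u k * f (k + 1, n)))"
    by (subst infsum_add[OF su summable_on_cmult_right[OF su']]) (simp add: infsum_cmult_right')
  also have "\<dots> = (\<Sum>\<^sub>\<infinity>k. u k * f (k + 1, Suc n) + \<i> * (u k * f (k, Suc n)))"
  proof (rule infsum_cong)
    fix k
    have "f (k, n) + \<i> * f (k + 1, n) - f (k + 1, n + 1) - \<i> * f (k, n + 1) = 0"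
      using Hp_level(3)[OF f] unfolding discrete_hol_def by blast
    hence "f (k, n) + \<i> * f (k + 1, n) = f (k + 1, Suc n) + \<i> * f (k, Suc n)"
      by (simp add: algebra_simps)
    from arg_cong[OF this, of "\<lambda>z. u k * z"]
    show "u k * f (k, n) + \<i> * (u k * f (k + 1, n)) = u k * f (k + 1, Suc n) + \<i> * (u k * f (k, Suc n))"
      by (simp add: algebra_simps)
  qed
  also have "\<dots> = (\<Sum>\<^sub>\<infinity>k. u k * f (k + 1, Suc n)) + \<i> * (\<Sum>\<^sub>\<infinity>k. u k * f (k, Suc n))"
    by (subst infsum_add[OF su' summable_on_cmult_right[OF su]]) (simp add: infsum_cmult_right')
  also have "\<dots> = (\<Sum>\<^sub>\<infinity>k. u k * f (k + 1, Suc n) + \<i> * (u (k + 1) * f (k + 1, Suc n)))"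
    by (subst infsum_add[OF su' summable_on_cmult_right[OF su1]]) (simp add: sh infsum_cmult_right')
  also have "\<dots> = (\<Sum>\<^sub>\<infinity>k. hardy_kernel (Suc n) (k + 1 - m) * f (k + 1, Suc n))"
    by (simp add: K2[symmetric] algebra_simps)
  also have "\<dots> = (\<Sum>\<^sub>\<infinity>k. hardy_kernel (Suc n) (k - m) * f (k, Suc n))"
    by (rule infsum_shift_int)
  finally show ?thesis .
qed

text \<open>The sum is the same at every level, and by Hoelder's inequality it is at most the
  \<open>\<ell>^q\<close> norm of the kernel at height \<open>n\<close> times
  \<open>Hp_norm p f\<close>, which tends to 0. So the bottom level has no component in the
  complementary half circle.\<close>

lemma reflected_kernel_sum_eq_0:
  assumes f: "f \<in> Hp p"
  shows "(\<Sum>\<^sub>\<infinity>k. hardy_kernel 0 (k - m) * f (k, 0)) = 0"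
proof -
  define G where "G = (\<lambda>n. \<Sum>\<^sub>\<infinity>k. hardy_kernel n (k - m) * f (k, n))"
  have const: "G n = G 0" for n
    by (induction n) (simp_all add: G_def reflected_kernel_sum_step[OF f, symmetric])
  have le: "norm (G 0) \<le> lp_norm q (hardy_kernel n) * Hp_norm p f" for n
  proof -
    have "norm (G n) \<le> lp_norm q (\<lambda>k. hardy_kernel n (k - m)) * lp_norm p (level f n)"
      using Holder_lp(3)[OF q1 qp in_lp_hardy_kernel(2)[OF q1] Hp_level(1)[OF f]]
      by (simp add: G_def level_def)
    also have "lp_norm q (\<lambda>k. hardy_kernel n (k - m)) = lp_norm q (hardy_kernel n)"
      by (rule lp_reindex(2)[OF bij_int_affine(2)])
    also have "\<dots> * lp_norm p (level f n) \<le> \<dots> * Hp_norm p f"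
      by (intro mult_left_mono Hp_level(2) f) simp
    finally show ?thesis by (simp only: const[of n])
  qed
  have "(\<lambda>n. lp_norm q (hardy_kernel n) * Hp_norm p f) \<longlonglongrightarrow> 0 * Hp_norm p f"
    by (intro tendsto_intros lp_norm_hardy_kernel_tendsto_0 q1)
  hence "norm (G 0) \<le> 0" using le by (intro LIMSEQ_le_const[of _ 0]) auto
  thus ?thesis by (simp add: G_def)
qed

text \<open>Adding the vanishing reflected sum turns the kernel into the identity.\<close>

lemma hardy_reproducing:
  assumes f: "f \<in> Hp p"
  shows "(\<Sum>\<^sub>\<infinity>k. hardy_kernel 0 (m - k) * f (k, 0)) = f (m, 0)"
proof -
  have s1: "(\<lambda>k. hardy_kernel 0 (m - k) * f (k, 0)) summable_on UNIV"
    using hardy_ext_summable[OF Hp_level(1)[OF f], of 0 m 0] by (simp add: level_def)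
  have eq: "hardy_kernel 0 (m - k) * f (k, 0) + hardy_kernel 0 (k - m) * f (k, 0)
      = (if k = m then f (m, 0) else 0)" for k
    using hardy_kernel_0_reflect[of "m - k"] by (simp flip: distrib_right)
  have "(\<Sum>\<^sub>\<infinity>k. hardy_kernel 0 (m - k) * f (k, 0)) =
      (\<Sum>\<^sub>\<infinity>k. hardy_kernel 0 (m - k) * f (k, 0)) + (\<Sum>\<^sub>\<infinity>k. hardy_kernel 0 (k - m) * f (k, 0))"
    by (simp add: reflected_kernel_sum_eq_0[OF f])
  also have "\<dots> = (\<Sum>\<^sub>\<infinity>k. if k = m then f (m, 0) else 0)"
    unfolding eq[symmetric] by (rule infsum_add[symmetric, OF s1 summable_level_hardy_kernel[OF f]])
  also have "\<dots> = (\<Sum>\<^sub>\<infinity>k\<in>{m}. f (m, 0))"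
    by (intro infsum_cong_neutral) auto
  finally show ?thesis by simp
qed

lemma hardy_ext_level_0:
  assumes f: "f \<in> Hp p"
  shows "hardy_ext (level f 0) = f"
proof -
  have "hardy_ext (level f 0) \<in> Hp p"
    by (rule hardy_ext_bounded) (use Hp_level(1)[OF f] in blast)
  thus ?thesis
    using hardy_reproducing[OF f] by (intro Hp_unique[OF p1 _ f]) (auto simp: hardy_ext_def level_def)
qed

end

subsection \<open>Duality\<close>

lemma zero_in_Hp: "p > 0 \<Longrightarrow> (\<lambda>_. 0) \<in> Hp p" and Hp_norm_zero: "p > 0 \<Longrightarrow> Hp_norm p (\<lambda>_. 0) = 0"
  by (auto simp: Hp_def Hp_norm_def discrete_hol_def in_lp_def lp_norm_def level_def)

text \<open>The supremum defining \<open>Hp_dual_norm\<close> carries information only for a set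
  that is bounded above.\<close>

lemma Hp_dual_bdd_above:
  assumes "\<phi> \<in> Hp_dual p"
  shows "bdd_above ((\<lambda>f. norm (\<phi> f)) ` {f \<in> Hp p. Hp_norm p f \<le> 1})"
proof -
  obtain C where C: "\<forall>f\<in>Hp p. norm (\<phi> f) \<le> C * Hp_norm p f"
    using assms unfolding Hp_dual_def by blast
  show ?thesis
  proof (rule bdd_aboveI2)
    fix f assume "f \<in> {f \<in> Hp p. Hp_norm p f \<le> 1}"
    hence f: "f \<in> Hp p" "Hp_norm p f \<le> 1" by auto
    have "norm (\<phi> f) \<le> C * Hp_norm p f" using C f by blast
    also have "\<dots> \<le> \<bar>C\<bar> * 1" using f Hp_norm_nonneg[OF f(1)] by (intro mult_mono) auto
    finally show "norm (\<phi> f) \<le> \<bar>C\<bar>" by simp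
  qed
qed

lemma Hp_dual_norm_nonneg:
  assumes "p > 0" "\<phi> \<in> Hp_dual p"
  shows "Hp_dual_norm p \<phi> \<ge> 0"
proof -
  have "norm (\<phi> (\<lambda>_. 0)) \<le> Hp_dual_norm p \<phi>"
    unfolding Hp_dual_norm_def using zero_in_Hp Hp_norm_zero assms
    by (intro cSUP_upper Hp_dual_bdd_above) auto
  thus ?thesis using norm_ge_zero order_trans by blast
qed

lemma Hp_dual_bound:
  assumes p: "p > 0" and \<phi>: "\<phi> \<in> Hp_dual p" and f: "f \<in> Hp p"
  shows "norm (\<phi> f) \<le> Hp_dual_norm p \<phi> * Hp_norm p f"
proof (cases "Hp_norm p f = 0")
  case True
  \<comment> \<open>Normalising \<open>f\<close> is impossible here; the constant in the definition
    of the dual shows \<open>\<phi> f = 0\<close> instead.\<close>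
  obtain C where "\<forall>f\<in>Hp p. norm (\<phi> f) \<le> C * Hp_norm p f"
    using \<phi> unfolding Hp_dual_def by blast
  hence "norm (\<phi> f) \<le> C * Hp_norm p f" using f by blast
  thus ?thesis using True by simp
next
  case False
  define r where "r = Hp_norm p f"
  have r: "r > 0" using False Hp_norm_nonneg[OF f] by (simp add: r_def)
  define g where "g = (\<lambda>z. of_real (1 / r) * f z)"
  have "norm (complex_of_real (1 / r)) * Hp_norm p f = 1"
    using r unfolding norm_of_real by (simp add: r_def)
  hence g: "g \<in> Hp p" "Hp_norm p g \<le> 1"
    using Hp_cmult[OF p f, of "of_real (1 / r)"] unfolding g_def by simp_all
  have "norm (\<phi> g) \<le> Hp_dual_norm p \<phi>"
    unfolding Hp_dual_norm_def using g by (intro cSUP_upper Hp_dual_bdd_above \<phi>) auto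
  moreover have "\<phi> g = of_real (1 / r) * \<phi> f"
    using \<phi> f unfolding Hp_dual_def g_def by blast
  hence "norm (\<phi> g) = norm (\<phi> f) / r" using r by (simp only: norm_mult norm_of_real) simp
  ultimately show ?thesis using r by (simp add: r_def[symmetric] divide_le_eq)
qed

section \<open>The pairing and its reproducing elements\<close>

lemma Hp_pairing:
  assumes p: "1 < p" and pq: "1 / p + 1 / q = 1" and f: "f \<in> Hp p" and g: "g \<in> Hp q"
  shows "(\<lambda>m. f (m, 0) * cnj (g (m, 0))) summable_on UNIV"
    "norm (pairing f g) \<le> Hp_norm p f * Hp_norm q g"
proof -
  have g': "in_lp q (\<lambda>m. cnj (g (m, 0)))" "lp_norm q (\<lambda>m. cnj (g (m, 0))) = lp_norm q (level g 0)"
    using Hp_level(1)[OF g, of 0] lp_cong_norm[of "\<lambda>m. cnj (g (m, 0))" "level g 0" q]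
    by (simp_all add: level_def)
  note H = Holder_lp[OF p pq Hp_level(1)[OF f, of 0] g'(1)]
  show "(\<lambda>m. f (m, 0) * cnj (g (m, 0))) summable_on UNIV" using H(2) by (simp add: level_def)
  have "norm (pairing f g) \<le> lp_norm p (level f 0) * lp_norm q (level g 0)"
    using H(3) g'(2) by (simp add: pairing_def level_def)
  also have "\<dots> \<le> Hp_norm p f * Hp_norm q g"
    using Hp_norm_nonneg[OF f] by (intro mult_mono Hp_level(2) f g) auto
  finally show "norm (pairing f g) \<le> Hp_norm p f * Hp_norm q g" .
qed

lemma pairing_add_left:
  assumes "1 < p" "1 / p + 1 / q = 1" "f \<in> Hp p" "f' \<in> Hp p" "g \<in> Hp q"
  shows "pairing (\<lambda>z. f z + f' z) g = pairing f g + pairing f' g"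
  unfolding pairing_def distrib_right
  by (rule infsum_add) (rule Hp_pairing(1)[OF assms(1,2)]; fact)+

lemma pairing_add_right:
  assumes "1 < p" "1 / p + 1 / q = 1" "f \<in> Hp p" "g \<in> Hp q" "h \<in> Hp q"
  shows "pairing f (\<lambda>z. g z + h z) = pairing f g + pairing f h"
  unfolding pairing_def complex_cnj_add distrib_left
  by (rule infsum_add) (rule Hp_pairing(1)[OF assms(1,2)]; fact)+

lemma pairing_cmult_left: "pairing (\<lambda>z. c * f z) g = c * pairing f g"
  unfolding pairing_def by (simp add: mult.assoc infsum_cmult_right')

lemma pairing_cmult_right: "pairing f (\<lambda>z. c * g z) = cnj c * pairing f g"
  unfolding pairing_def by (simp add: mult.left_commute infsum_cmult_right')

text \<open>\<open>hardy_ext (unit_seq k)\<close> is the reproducing element at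
  \<open>(k, 0)\<close>: conjugate symmetry of the kernel turns the pairing into the conjugate of
  the reproducing sum of \<open>g\<close>.\<close>

lemma pairing_ext_unit_left:
  assumes "1 < q" "1 / q + 1 / p = 1" "g \<in> Hp q"
  shows "pairing (hardy_ext (unit_seq k)) g = cnj (g (k, 0))"
proof -
  have "hardy_kernel 0 (m - k) = cnj (hardy_kernel 0 (k - m))" for m
    by (simp add: cnj_hardy_kernel_0)
  hence "pairing (hardy_ext (unit_seq k)) g = (\<Sum>\<^sub>\<infinity>m. cnj (hardy_kernel 0 (k - m) * g (m, 0)))"
    by (simp add: pairing_def hardy_ext_unit_seq[OF assms(1,2)])
  also have "\<dots> = cnj (\<Sum>\<^sub>\<infinity>m. hardy_kernel 0 (k - m) * g (m, 0))"
    by (rule infsum_cnj)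
  also have "\<dots> = cnj (g (k, 0))" by (simp add: hardy_reproducing[OF assms])
  finally show ?thesis .
qed

lemma pairing_ext_unit_right:
  assumes "1 < p" "1 / p + 1 / q = 1" "f \<in> Hp p"
  shows "pairing f (hardy_ext (unit_seq k)) = f (k, 0)"
proof -
  have "pairing f (hardy_ext (unit_seq k)) = (\<Sum>\<^sub>\<infinity>m. hardy_kernel 0 (k - m) * f (m, 0))"
    by (simp add: pairing_def hardy_ext_unit_seq[OF assms(1,2)] cnj_hardy_kernel_0 mult.commute)
  thus ?thesis by (simp add: hardy_reproducing[OF assms])
qed

text \<open>Self-adjointness of the projection: pairing \<open>f\<close> with the projection of
  \<open>b\<close> is pairing it with \<open>b\<close> itself. This is checked on unit sequences and
  extended by continuity; the conjugate makes the functional linear in \<open>b\<close>.\<close>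

lemma pairing_hardy_ext_has_sum:
  assumes p: "1 < p" and pq: "1 / p + 1 / q = 1" and f: "f \<in> Hp p" and b: "in_lp q b"
  shows "((\<lambda>k. b k * cnj (f (k, 0))) has_sum cnj (pairing f (hardy_ext b))) UNIV"
proof -
  note c = conjugate_exponent[OF p pq]
  obtain C where C: "C \<ge> 0" "\<And>a. in_lp q a \<Longrightarrow> hardy_ext a \<in> Hp q"
    "\<And>a. in_lp q a \<Longrightarrow> Hp_norm q (hardy_ext a) \<le> C * lp_norm q a"
    by (rule hardy_ext_bounded[OF c(1,4)]) blast
  have "((\<lambda>k. b k * cnj (pairing f (hardy_ext (unit_seq k)))) has_sum cnj (pairing f (hardy_ext b))) UNIV"
  proof (rule bounded_functional_has_sum(1)[where p = q and M = "Hp_norm p f * C"])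
    show "1 \<le> q" "in_lp q b" using c b by auto
    fix x y assume x: "in_lp q x" and y: "in_lp q y"
    show "cnj (pairing f (hardy_ext (\<lambda>k. x k + y k))) = cnj (pairing f (hardy_ext x)) + cnj (pairing f (hardy_ext y))"
      by (simp add: hardy_ext_add[OF c(1,4) x y] pairing_add_right[OF p pq f C(2)[OF x] C(2)[OF y]])
  next
    fix x c' assume "in_lp q x"
    show "cnj (pairing f (hardy_ext (\<lambda>k. c' * x k))) = c' * cnj (pairing f (hardy_ext x))"
      by (simp add: hardy_ext_cmult[OF c(1,4)] pairing_cmult_right)
  next
    fix x assume x: "in_lp q x"
    have "norm (pairing f (hardy_ext x)) \<le> Hp_norm p f * Hp_norm q (hardy_ext x)"
      by (rule Hp_pairing(2)[OF p pq f C(2)[OF x]])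
    also have "\<dots> \<le> Hp_norm p f * (C * lp_norm q x)"
      by (intro mult_left_mono C(3) x Hp_norm_nonneg f)
    finally show "norm (cnj (pairing f (hardy_ext x))) \<le> Hp_norm p f * C * lp_norm q x"
      by (simp add: mult.assoc)
  qed
  thus ?thesis by (simp add: pairing_ext_unit_right[OF p pq f])
qed

text \<open>Composition with \<open>hardy_ext\<close> turns \<open>\<phi>\<close> into a bounded
  functional on all of \<open>\<ell>^p\<close>, whose coefficients form an \<open>\<ell>^q\<close>
  sequence \<open>b\<close>. Self-adjointness allows \<open>b\<close> to be replaced by its
  projection, which lies in \<open>H^q\<close>. \<open>C\<close> and \<open>D\<close> are the bounds
  of the projection on \<open>\<ell>^p\<close> and \<open>\<ell>^q\<close>.\<close>

lemma Hp_dual_representation: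
  assumes p: "1 < p" and pq: "1 / p + 1 / q = 1"
  obtains K where "\<And>\<phi>. \<phi> \<in> Hp_dual p \<Longrightarrow>
    \<exists>g\<in>Hp q. (\<forall>f\<in>Hp p. \<phi> f = pairing f g) \<and> Hp_norm q g \<le> K * Hp_dual_norm p \<phi>"
proof -
  note c = conjugate_exponent[OF p pq]
  have p0: "p > 0" using p by simp
  obtain C where C: "C \<ge> 0" "\<And>a. in_lp p a \<Longrightarrow> hardy_ext a \<in> Hp p"
    "\<And>a. in_lp p a \<Longrightarrow> Hp_norm p (hardy_ext a) \<le> C * lp_norm p a"
    by (rule hardy_ext_bounded[OF p pq]) blast
  obtain D where D: "D \<ge> 0" "\<And>a. in_lp q a \<Longrightarrow> hardy_ext a \<in> Hp q"
    "\<And>a. in_lp q a \<Longrightarrow> Hp_norm q (hardy_ext a) \<le> D * lp_norm q a"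
    by (rule hardy_ext_bounded[OF c(1,4)]) blast
  show ?thesis
  proof (rule that[of "D * C"])
    fix \<phi> assume \<phi>: "\<phi> \<in> Hp_dual p"
    define N where "N = Hp_dual_norm p \<phi>"
    have N0: "N \<ge> 0" unfolding N_def by (rule Hp_dual_norm_nonneg[OF p0 \<phi>])
    define L where "L = (\<lambda>a. \<phi> (hardy_ext a))"
    define b where "b = (\<lambda>k. cnj (L (unit_seq k)))"
    have add: "L (\<lambda>k. x k + y k) = L x + L y" if x: "in_lp p x" and y: "in_lp p y" for x y
      using \<phi> C(2)[OF x] C(2)[OF y] by (simp add: L_def hardy_ext_add[OF p pq x y] Hp_dual_def)
    have scale: "L (\<lambda>k. c * x k) = c * L x" if x: "in_lp p x" for c x
      using \<phi> C(2)[OF x] by (simp add: L_def hardy_ext_cmult[OF p pq] Hp_dual_def)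
    have bound: "norm (L x) \<le> C * N * lp_norm p x" if x: "in_lp p x" for x
    proof -
      have "norm (L x) \<le> N * Hp_norm p (hardy_ext x)"
        unfolding L_def N_def by (rule Hp_dual_bound[OF p0 \<phi> C(2)[OF x]])
      also have "\<dots> \<le> N * (C * lp_norm p x)" by (intro mult_left_mono C(3) x N0)
      finally show ?thesis by (simp add: mult_ac)
    qed
    have fin: "fin_norm q F b \<le> C * N" if F: "finite F" for F
    proof -
      have "fin_norm q F (\<lambda>k. L (unit_seq k)) \<le> C * N"
      proof (rule converse_Holder_finite[OF F c(1,4)])
        show "C * N \<ge> 0" using C N0 by simp
        fix a :: "int \<Rightarrow> complex"
        have fs: "in_lp p (restrict_seq F a)" "lp_norm p (restrict_seq F a) = fin_norm p F a"
          by (rule in_lp_finite_support[OF p0 F])+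
        \<comment> \<open>\<open>a\<close> is arbitrary, so its finite section takes the place of
          the \<open>\<ell>^p\<close> sequence and is restricted once more.\<close>
        have "L (restrict_seq F (restrict_seq F a)) = (\<Sum>k\<in>F. restrict_seq F a k * L (unit_seq k))"
          by (rule bounded_functional_has_sum(2)[OF less_imp_le[OF p] fs(1) add scale bound F])
        hence "(\<Sum>k\<in>F. a k * L (unit_seq k)) = L (restrict_seq F a)"
          by (simp add: restrict_seq_def cong: if_cong)
        thus "norm (\<Sum>k\<in>F. a k * L (unit_seq k)) \<le> C * N * fin_norm p F a"
          using bound[OF fs(1)] fs(2) by simp
      qed
      thus ?thesis using fin_norm_cong[of F b "\<lambda>k. L (unit_seq k)" q] by (simp add: b_def)
    qed
    have q0: "q > 0" using c by simp
    have b: "in_lp q b" "lp_norm q b \<le> C * N" using in_lpI[OF q0 fin] by auto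
    show "\<exists>g\<in>Hp q. (\<forall>f\<in>Hp p. \<phi> f = pairing f g) \<and> Hp_norm q g \<le> D * C * Hp_dual_norm p \<phi>"
    proof (intro bexI conjI ballI)
      show "hardy_ext b \<in> Hp q" by (rule D(2)[OF b(1)])
      have "Hp_norm q (hardy_ext b) \<le> D * lp_norm q b" by (rule D(3)[OF b(1)])
      also have "\<dots> \<le> D * (C * N)" by (intro mult_left_mono b(2) D(1))
      finally show "Hp_norm q (hardy_ext b) \<le> D * C * Hp_dual_norm p \<phi>" by (simp add: N_def mult_ac)
      fix f assume f: "f \<in> Hp p"
      have "((\<lambda>k. f (k, 0) * L (unit_seq k)) has_sum L (level f 0)) UNIV"
        using bounded_functional_has_sum(1)[OF less_imp_le[OF p] Hp_level(1)[OF f, of 0] add scale bound]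
        unfolding level_def .
      hence "((\<lambda>k. cnj (b k * cnj (f (k, 0)))) has_sum \<phi> f) UNIV"
        unfolding L_def hardy_ext_level_0[OF p pq f] b_def complex_cnj_mult complex_cnj_cnj
        by (simp only: mult.commute)
      moreover have "((\<lambda>k. cnj (b k * cnj (f (k, 0)))) has_sum pairing f (hardy_ext b)) UNIV"
        using pairing_hardy_ext_has_sum[OF p pq f b(1)]
        by (subst (asm) has_sum_cnj_iff[symmetric]) simp
      ultimately show "\<phi> f = pairing f (hardy_ext b)" by (rule has_sum_unique)
    qed
  qed
qed

theorem theorem6p3:
  fixes p q :: real
  assumes "1 < p" and "1 / p + 1 / q = 1"
  shows "(\<forall>f\<in>Hp p. \<forall>g\<in>Hp q. (\<lambda>m. f (m, 0) * cnj (g (m, 0))) summable_on UNIV) \<and>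
    (\<exists>\<Phi>. antilinear_iso_to_dual q p \<Phi> \<and> (\<forall>g\<in>Hp q. \<forall>f\<in>Hp p. \<Phi> g f = pairing f g))"
proof -
  note p = assms(1) and pq = assms(2)
  note c = conjugate_exponent[OF p pq]
  have p0: "p > 0" and p1: "1 \<le> p" and q0: "q > 0" and q1: "1 \<le> q" using p c by auto
  \<comment> \<open>The value 0 off \<open>Hp p\<close> selects the unique representative that
    \<open>Hp_dual\<close> prescribes.\<close>
  define \<Phi> where "\<Phi> = (\<lambda>g f. if f \<in> Hp p then pairing f g else 0)"
  obtain K where K: "\<And>\<phi>. \<phi> \<in> Hp_dual p \<Longrightarrow>
    \<exists>g\<in>Hp q. (\<forall>f\<in>Hp p. \<phi> f = pairing f g) \<and> Hp_norm q g \<le> K * Hp_dual_norm p \<phi>"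
    by (rule Hp_dual_representation[OF p pq]) blast
  have inj: "inj_on \<Phi> (Hp q)"
  proof (rule inj_onI)
    fix g h assume g: "g \<in> Hp q" and h: "h \<in> Hp q" and eq: "\<Phi> g = \<Phi> h"
    \<comment> \<open>The reproducing elements lie in \<open>H^p\<close> and recover the bottom
      level, which determines the whole function.\<close>
    have "cnj (g (k, 0)) = cnj (h (k, 0))" for k
      using fun_cong[OF eq, of "hardy_ext (unit_seq k)"] hardy_ext_unit_in_Hp[OF p pq, of k]
      by (simp add: \<Phi>_def pairing_ext_unit_left[OF c(1,4)] g h)
    thus "g = h" by (intro Hp_unique[OF q1 g h]) (simp only: complex_cnj_cancel_iff)
  qed
  have dual: "\<Phi> g \<in> Hp_dual p" if g: "g \<in> Hp q" for g
    unfolding Hp_dual_def mem_Collect_eq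
  proof (intro conjI ballI allI impI exI)
    fix f f' assume "f \<in> Hp p" "f' \<in> Hp p"
    thus "\<Phi> g (\<lambda>z. f z + f' z) = \<Phi> g f + \<Phi> g f'"
      by (simp add: \<Phi>_def Hp_add[OF p1] pairing_add_left[OF p pq _ _ g])
  next
    fix a f assume "f \<in> Hp p"
    thus "\<Phi> g (\<lambda>z. a * f z) = a * \<Phi> g f"
      by (simp add: \<Phi>_def Hp_cmult(1)[OF p0] pairing_cmult_left)
  next
    fix f assume "f \<in> Hp p"
    thus "norm (\<Phi> g f) \<le> Hp_norm q g * Hp_norm p f"
      using Hp_pairing(2)[OF p pq _ g, of f] by (simp add: \<Phi>_def mult.commute)
  qed (simp add: \<Phi>_def)
  have rep: "\<exists>g\<in>Hp q. \<Phi> g = \<phi> \<and> Hp_norm q g \<le> K * Hp_dual_norm p \<phi>" if \<phi>: "\<phi> \<in> Hp_dual p" for \<phi>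
  proof -
    obtain g where g: "g \<in> Hp q" "\<And>f. f \<in> Hp p \<Longrightarrow> \<phi> f = pairing f g" "Hp_norm q g \<le> K * Hp_dual_norm p \<phi>"
      using K[OF \<phi>] by blast
    have "\<phi> f = 0" if "f \<notin> Hp p" for f using \<phi> that by (simp add: Hp_dual_def)
    hence "\<Phi> g = \<phi>" using g(2) by (auto simp: \<Phi>_def)
    thus ?thesis using g by blast
  qed
  have "antilinear_iso_to_dual q p \<Phi>"
    unfolding antilinear_iso_to_dual_def
  proof (intro conjI ballI allI)
    fix g h assume "g \<in> Hp q" "h \<in> Hp q"
    thus "\<Phi> (\<lambda>z. g z + h z) = (\<lambda>f. \<Phi> g f + \<Phi> h f)"
      by (auto simp: \<Phi>_def pairing_add_right[OF p pq])
  next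
    fix a g assume "g \<in> Hp q"
    show "\<Phi> (\<lambda>z. a * g z) = (\<lambda>f. cnj a * \<Phi> g f)"
      by (auto simp: \<Phi>_def pairing_cmult_right)
  next
    show "bij_betw \<Phi> (Hp q) (Hp_dual p)"
      unfolding bij_betw_def using inj dual rep by blast
  next
    show "\<exists>C. \<forall>g\<in>Hp q. Hp_dual_norm p (\<Phi> g) \<le> C * Hp_norm q g"
    proof (intro exI ballI)
      fix g assume g: "g \<in> Hp q"
      show "Hp_dual_norm p (\<Phi> g) \<le> 1 * Hp_norm q g"
        unfolding Hp_dual_norm_def
      proof (rule cSUP_least)
        show "{f \<in> Hp p. Hp_norm p f \<le> 1} \<noteq> {}" using zero_in_Hp[OF p0] Hp_norm_zero[OF p0] by force
        fix f assume "f \<in> {f \<in> Hp p. Hp_norm p f \<le> 1}"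
        hence f: "f \<in> Hp p" "Hp_norm p f \<le> 1" by auto
        have "norm (\<Phi> g f) \<le> Hp_norm p f * Hp_norm q g"
          using Hp_pairing(2)[OF p pq f(1) g] f by (simp add: \<Phi>_def)
        also have "\<dots> \<le> 1 * Hp_norm q g" using f Hp_norm_nonneg[OF g] by (intro mult_right_mono) auto
        finally show "norm (\<Phi> g f) \<le> 1 * Hp_norm q g" .
      qed
    qed
  next
    show "\<exists>C. \<forall>\<phi>\<in>Hp_dual p. Hp_norm q (inv_into (Hp q) \<Phi> \<phi>) \<le> C * Hp_dual_norm p \<phi>"
    proof (intro exI ballI)
      fix \<phi> assume "\<phi> \<in> Hp_dual p"
      then obtain g where g: "g \<in> Hp q" "\<Phi> g = \<phi>" "Hp_norm q g \<le> K * Hp_dual_norm p \<phi>"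
        using rep by blast
      \<comment> \<open>By injectivity the inverse image is the representing function just obtained,
        so its norm bound carries over.\<close>
      thus "Hp_norm q (inv_into (Hp q) \<Phi> \<phi>) \<le> K * Hp_dual_norm p \<phi>"
        using inv_into_f_f[OF inj g(1)] by simp
    qed
  qed
  moreover have "\<forall>g\<in>Hp q. \<forall>f\<in>Hp p. \<Phi> g f = pairing f g" by (simp add: \<Phi>_def)
  ultimately show ?thesis using Hp_pairing(1)[OF p pq] by blast
qed

end
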